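(* (i) Let $X$ be a complex Fréchet space and let $T\in\mathcal{L}_c(X)$ be nonscalar. Then $T$ has a nontrivial hyperinvariant linear manifold, i.e., there exists a nontrivial linear manifold in $X$ that is invariant under all continuous linear operators that commute with $T$. (ii) Let $X$ be a real Fréchet space and let $T\in\mathcal{L}_c(X)$ be nonquadratic, i.e., $T$ does not have a vanishing polynomial with real coefficients of degree at most two. Then $T$ has a nontrivial hyperinvariant linear manifold, i.e., there exists a nontrivial linear manifold in $X$ that is invariant under all continuous linear operators that commute with $T$.
   Context: A Fréchet space is a locally convex topological vector space whose topology is generated by a complete invariant metric. $\mathcal{L}_c(X)$ denotes the algebra of all continuous linear operators on $X$. An operator is nonscalar if it is not a scalar multiple of the identity $I_X$. "Vanishing polynomial" means a nonzero polynomial $p$ with $p(T)=0$. A linear manifold is a linear subspace, not necessarily closed; it is nontrivial if it is neither $\{0\}$ nor $X$. *)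

theory Defs
  imports "HOL-Analysis.Analysis" "HOL-Computational_Algebra.Polynomial"
begin

text \<open>
  A Frechet space is modelled on a whole type, with an explicit scalar multiplication so that the
  real and the complex case share one definition. Joint continuity of addition is part of the class
  \<^class>\<open>topological_ab_group_add\<close>; the metric axiom makes the topology Hausdorff.
  Convexity refers to real scalars, embedded into the scalar field by \<^term>\<open>of_real\<close>.
\<close>

definition convex_wrt :: "('k::real_normed_field \<Rightarrow> 'a::ab_group_add \<Rightarrow> 'a) \<Rightarrow> 'a set \<Rightarrow> bool" where
  "convex_wrt smul C \<longleftrightarrow>
     (\<forall>x\<in>C. \<forall>y\<in>C. \<forall>t::real. 0 \<le> t \<and> t \<le> 1 \<longrightarrow>
        smul (of_real (1 - t)) x + smul (of_real t) y \<in> C)"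

locale frechet_space = vector_space smul
  for smul :: "'k::real_normed_field \<Rightarrow> 'a::topological_ab_group_add \<Rightarrow> 'a" +
  assumes continuous_scale: "continuous_on UNIV (\<lambda>(c, x). smul c x)"
    and locally_convex: "\<And>U. open U \<Longrightarrow> 0 \<in> U \<Longrightarrow>
      \<exists>V. open V \<and> 0 \<in> V \<and> V \<subseteq> U \<and> convex_wrt smul V"
    and complete_invariant_metric:
      "\<exists>d :: 'a \<Rightarrow> 'a \<Rightarrow> real. Metric_space UNIV d \<and> Metric_space.mcomplete UNIV d \<and>
           Metric_space.mtopology UNIV d = euclidean \<and>
           (\<forall>x y z. d (x + z) (y + z) = d x y)"

definition continuous_linear_ops ::
    "('k::field \<Rightarrow> 'a::{ab_group_add, topological_space} \<Rightarrow> 'a) \<Rightarrow> ('a \<Rightarrow> 'a) set" where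
  "continuous_linear_ops smul = {T. Vector_Spaces.linear smul smul T \<and> continuous_on UNIV T}"

definition scalar_operator :: "('k \<Rightarrow> 'a \<Rightarrow> 'a) \<Rightarrow> ('a \<Rightarrow> 'a) \<Rightarrow> bool" where
  "scalar_operator smul T \<longleftrightarrow> (\<exists>c. \<forall>x. T x = smul c x)"

definition poly_operator ::
    "('k::field \<Rightarrow> 'a::ab_group_add \<Rightarrow> 'a) \<Rightarrow> 'k poly \<Rightarrow> ('a \<Rightarrow> 'a) \<Rightarrow> 'a \<Rightarrow> 'a" where
  "poly_operator smul p T = (\<lambda>x. \<Sum>i\<le>degree p. smul (coeff p i) ((T ^^ i) x))"

definition vanishing_polynomial ::
    "('k::field \<Rightarrow> 'a::ab_group_add \<Rightarrow> 'a) \<Rightarrow> ('a \<Rightarrow> 'a) \<Rightarrow> 'k poly \<Rightarrow> bool" where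
  "vanishing_polynomial smul T p \<longleftrightarrow> p \<noteq> 0 \<and> (\<forall>x. poly_operator smul p T x = 0)"

definition nonquadratic :: "(real \<Rightarrow> 'a::ab_group_add \<Rightarrow> 'a) \<Rightarrow> ('a \<Rightarrow> 'a) \<Rightarrow> bool" where
  "nonquadratic smul T \<longleftrightarrow> \<not> (\<exists>p. degree p \<le> 2 \<and> vanishing_polynomial smul T p)"

definition nontrivial_manifold :: "('k::field \<Rightarrow> 'a::ab_group_add \<Rightarrow> 'a) \<Rightarrow> 'a set \<Rightarrow> bool" where
  "nontrivial_manifold smul M \<longleftrightarrow> module.subspace smul M \<and> M \<noteq> {0} \<and> M \<noteq> UNIV"

definition hyperinvariant ::
    "('k::field \<Rightarrow> 'a::{ab_group_add, topological_space} \<Rightarrow> 'a) \<Rightarrow> ('a \<Rightarrow> 'a) \<Rightarrow> 'a set \<Rightarrow> bool" where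
  "hyperinvariant smul T M \<longleftrightarrow>
     (\<forall>S\<in>continuous_linear_ops smul. S \<circ> T = T \<circ> S \<longrightarrow> S ` M \<subseteq> M)"

end

theory Submission
  imports Defs
begin

text \<open>
  Everything is reduced to a real Frechet space \<open>X\<close> and a set \<open>A\<close> of continuous operators, containing and
  commuting with \<open>T\<close>, whose only invariant manifolds are \<open>{0}\<close> and \<open>X\<close> (in the complex case \<open>A\<close>
  contains the multiplication by \<open>i\<close>). Kernels and ranges show that the linear maps commuting with \<open>A\<close>
  form a division ring; they need not be continuous, but the vectors at which a given sequence of them
  converges form an invariant manifold as well, so convergence at one nonzero vector is
  convergence everywhere.

  If no operator \<open>(T - a)\<^sup>2 + b\<^sup>2\<close> vanishes, they are all invertible. If \<open>b\<^sub>n \<rightarrow> 1\<close> pointwise in the centre of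
  the division ring, then a sparse subproduct \<open>b\<^sub>1 \<cdots> b\<^sub>n\<close> converges to an invertible \<open>u\<close> and its inverses
  converge to \<open>u\<^sup>-\<^sup>1\<close>; a gliding hump argument upgrades this to \<open>b\<^sub>n\<^sup>-\<^sup>1 \<rightarrow> 1\<close>. Hence the resolvent of the
  complexification of \<open>T\<close> is a continuous function on the plane that vanishes at infinity, which
  contradicts the maximum principle. So \<open>T\<close> is annihilated by a real quadratic polynomial; over
  the complex numbers the latter splits, and \<open>T\<close> is scalar.
\<close>

text \<open>Greedy choice: requirement \<open>k\<close> holds for all large \<open>n\<close> and, by
  \<open>cong\<close>, depends only on the earlier choices, so \<open>s k\<close> can be taken
  beyond all of them. The constructions of sparse products and series below state their smallness
  demands as such a \<open>P\<close>.\<close>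

lemma subsequence_choice:
  fixes P :: "nat \<Rightarrow> (nat \<Rightarrow> nat) \<Rightarrow> nat \<Rightarrow> bool"
  assumes ev: "\<And>k s. eventually (P k s) sequentially"
    and cong: "\<And>k s t n. (\<And>i. i < k \<Longrightarrow> s i = t i) \<Longrightarrow> P k s n \<Longrightarrow> P k t n"
  shows "\<exists>s. strict_mono s \<and> (\<forall>k. P k s (s k))"
proof -
  define pick where "pick k h = (SOME n. (\<forall>i<k. h i < n) \<and> P k h n)" for k :: nat and h
  have pick: "(\<forall>i<k. h i < pick k h) \<and> P k h (pick k h)" for k h
  proof -
    have "eventually (\<lambda>n. \<forall>i\<in>{..<k}. h i < n) sequentially"
      by (intro eventually_ball_finite) (auto intro: eventually_gt_at_top)
    then have "eventually (\<lambda>n. (\<forall>i<k. h i < n) \<and> P k h n) sequentially"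
      using ev[of k h] by eventually_elim auto
    then have "\<exists>n. (\<forall>i<k. h i < n) \<and> P k h n"
      using eventually_happens by force
    then show ?thesis unfolding pick_def by (rule someI_ex)
  qed
  \<comment> \<open>\<open>g k\<close> is the history after \<open>k\<close> choices, filled up with
    \<open>0\<close>. Later stages never alter an entry below \<open>k\<close>, so the diagonal
    \<open>s\<close> agrees with it there.\<close>
  define g where "g = rec_nat (\<lambda>_. 0) (\<lambda>k h. h(k := pick k h))"
  have gS: "g (Suc k) = (g k)(k := pick k (g k))" for k by (simp add: g_def)
  define s where "s i = g (Suc i) i" for i
  have g_eq: "g k i = s i" if "i < k" for i k
    using that by (induction k) (auto simp: gS s_def less_Suc_eq)
  have s_eq: "s k = pick k (g k)" for k by (simp add: s_def gS)
  have "s i < s k" if "i < k" for i k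
    using pick[of k "g k"] that g_eq[OF that] by (simp add: s_eq[of k]) metis
  moreover have "P k s (s k)" for k
    using pick[of k "g k"] by (auto simp: s_eq[of k] intro: cong[of k "g k" s, OF g_eq])
  ultimately show ?thesis by (auto simp: strict_mono_def)
qed

section \<open>The invariant metric and continuous gauges\<close>

locale real_frechet_space = frechet_space smul
  for smul :: "real \<Rightarrow> 'a::topological_ab_group_add \<Rightarrow> 'a"
begin

definition inv_dist :: "'a \<Rightarrow> 'a \<Rightarrow> real" where
  "inv_dist = (SOME d. Metric_space UNIV d \<and> Metric_space.mcomplete UNIV d \<and>
     Metric_space.mtopology UNIV d = euclidean \<and> (\<forall>x y z. d (x + z) (y + z) = d x y))"

lemma inv_dist:
  "Metric_space UNIV inv_dist" "Metric_space.mcomplete UNIV inv_dist"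
  "Metric_space.mtopology UNIV inv_dist = euclidean"
  "inv_dist (x + z) (y + z) = inv_dist x y"
  using someI_ex[OF complete_invariant_metric] unfolding inv_dist_def[symmetric] by auto

text \<open>An F-norm: subadditive and symmetric, but in general not homogeneous, so estimates with
  it use only sums and signs.\<close>

definition fnorm :: "'a \<Rightarrow> real" where "fnorm x = inv_dist x 0"

lemma inv_dist_eq: "inv_dist x y = fnorm (x - y)"
  unfolding fnorm_def using inv_dist(4)[of "x - y" y 0] by simp

lemma fnorm_nonneg [simp]: "0 \<le> fnorm x"
  by (simp add: fnorm_def Metric_space.nonneg[OF inv_dist(1)])

lemma fnorm_eq_0 [simp]: "fnorm x = 0 \<longleftrightarrow> x = 0"
  by (simp add: fnorm_def Metric_space.zero[OF inv_dist(1)])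

lemma fnorm_0 [simp]: "fnorm 0 = 0"
  by simp

lemma fnorm_minus [simp]: "fnorm (- x) = fnorm x"
  using Metric_space.commute[OF inv_dist(1), of x 0] by (simp add: inv_dist_eq)

lemma fnorm_add: "fnorm (x + y) \<le> fnorm x + fnorm y"
  using Metric_space.triangle[OF inv_dist(1), of x 0 "- y"] by (simp add: inv_dist_eq)

lemma fnorm_diff_commute: "fnorm (x - y) = fnorm (y - x)"
  using fnorm_minus[of "x - y"] by simp

lemma tendsto_fnorm_iff: "(f \<longlongrightarrow> l) F \<longleftrightarrow> ((\<lambda>n. fnorm (f n - l)) \<longlongrightarrow> 0) F"
proof -
  have "(f \<longlongrightarrow> l) F \<longleftrightarrow> limitin (Metric_space.mtopology UNIV inv_dist) f l F"
    by (simp add: inv_dist(3))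
  also have "\<dots> \<longleftrightarrow> (\<forall>e>0. \<forall>\<^sub>F n in F. fnorm (f n - l) < e)"
    by (simp add: Metric_space.limitin_metric[OF inv_dist(1)] inv_dist_eq)
  also have "\<dots> \<longleftrightarrow> ((\<lambda>n. fnorm (f n - l)) \<longlongrightarrow> 0) F"
    by (simp add: tendsto_iff)
  finally show ?thesis .
qed

lemma tendsto_fnorm_0: "(f \<longlongrightarrow> 0) F \<longleftrightarrow> ((\<lambda>n. fnorm (f n)) \<longlongrightarrow> 0) F"
  by (simp add: tendsto_fnorm_iff[of f])

lemma tendsto_fnorm: "(f \<longlongrightarrow> l) F \<Longrightarrow> ((\<lambda>n. fnorm (f n)) \<longlongrightarrow> fnorm l) F"
proof -
  assume "(f \<longlongrightarrow> l) F"
  then have *: "((\<lambda>n. fnorm (f n - l)) \<longlongrightarrow> 0) F" by (simp add: tendsto_fnorm_iff)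
  have "\<bar>fnorm (f n) - fnorm l\<bar> \<le> fnorm (f n - l)" for n
    using fnorm_add[of "f n - l" l] fnorm_add[of "l - f n" "f n"] fnorm_diff_commute[of l "f n"] by simp
  then have "((\<lambda>n. fnorm (f n) - fnorm l) \<longlongrightarrow> 0) F"
    by (intro Lim_null_comparison[OF _ *]) auto
  then show ?thesis by (simp add: LIM_zero_iff)
qed

text \<open>The type class does not contain the separation axiom; it comes from the metric.\<close>
lemma limit_unique:
  fixes f :: "'b \<Rightarrow> 'a"
  assumes "(f \<longlongrightarrow> l) F" "(f \<longlongrightarrow> m) F" "F \<noteq> bot"
  shows "l = m"
proof -
  have "((\<lambda>n. f n - f n) \<longlongrightarrow> l - m) F" using assms by (intro tendsto_diff)
  then have "((\<lambda>n. fnorm (f n - f n)) \<longlongrightarrow> fnorm (l - m)) F" by (rule tendsto_fnorm)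
  then have "((\<lambda>n. 0::real) \<longlongrightarrow> fnorm (l - m)) F" by (simp add: iffD2[OF fnorm_eq_0])
  then have "fnorm (l - m) = 0" using tendsto_unique[OF assms(3)] tendsto_const by blast
  then show ?thesis by simp
qed

lemma tendsto_smul:
  assumes "(c \<longlongrightarrow> c0) F" "(y \<longlongrightarrow> y0) F"
  shows "((\<lambda>n. smul (c n) (y n)) \<longlongrightarrow> smul c0 y0) F"
proof -
  have "((\<lambda>n. (\<lambda>(c, x). smul c x) (c n, y n)) \<longlongrightarrow> (\<lambda>(c, x). smul c x) (c0, y0)) F"
    using assms by (intro continuous_on_tendsto_compose[OF continuous_scale] tendsto_Pair) auto
  then show ?thesis by simp
qed

text \<open>The increments are dominated by a geometric series, so completeness gives a limit, and
  the error is the tail sum from \<open>m\<close>. This explicit error controls the tails of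
  products and series later.\<close>

lemma geometric_convergence:
  assumes step: "\<And>k. m \<le> k \<Longrightarrow> fnorm (y (Suc k) - y k) \<le> c * (1/2)^k"
  shows "\<exists>l. y \<longlonglongrightarrow> l \<and> fnorm (l - y m) \<le> 2 * c * (1/2)^m"
proof -
  have c0: "0 \<le> c"
  proof (rule ccontr)
    assume "\<not> 0 \<le> c"
    then have "c * (1/2)^m < 0" by (intro mult_neg_pos) auto
    then show False using order_trans[OF fnorm_nonneg step[of m]] by simp
  qed
  have bound: "fnorm (y (n + j) - y n) \<le> 2 * c * ((1/2)^n - (1/2)^(n+j))" if "m \<le> n" for n j
  proof (induction j)
    case 0
    then show ?case by (simp add: iffD2[OF fnorm_eq_0])
  next
    case (Suc j)
    have "fnorm (y (n + Suc j) - y n) \<le> fnorm (y (Suc (n + j)) - y (n + j)) + fnorm (y (n + j) - y n)"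
      using fnorm_add[of "y (Suc (n + j)) - y (n + j)" "y (n + j) - y n"] by simp
    also have "\<dots> \<le> c * (1/2)^(n+j) + 2 * c * ((1/2)^n - (1/2)^(n+j))"
      using step[of "n + j"] Suc that by simp
    also have "\<dots> = 2 * c * ((1/2)^n - (1/2)^(n+Suc j))" by (simp add: algebra_simps)
    finally show ?case .
  qed
  have bound': "fnorm (y k - y n) \<le> 2 * c * (1/2)^n" if "m \<le> n" "n \<le> k" for n k
  proof -
    have "fnorm (y k - y n) \<le> 2 * c * ((1/2)^n - (1/2)^k)"
      using bound[OF that(1), of "k - n"] that(2) by simp
    also have "\<dots> \<le> 2 * c * (1/2)^n" using c0 by (intro mult_left_mono) auto
    finally show ?thesis .
  qed
  have "Metric_space.MCauchy UNIV inv_dist y"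
    unfolding Metric_space.MCauchy_def[OF inv_dist(1)]
  proof (intro conjI allI impI)
    fix e :: real assume "e > 0"
    have "(\<lambda>n. 2 * c * (1/2)^n) \<longlonglongrightarrow> 2 * c * 0"
      by (intro tendsto_mult tendsto_const LIMSEQ_power_zero) auto
    then have "eventually (\<lambda>n. 2 * c * (1/2)^n < e) sequentially"
      using \<open>e > 0\<close> by (auto dest: order_tendstoD)
    then obtain N where N: "\<And>n. n \<ge> N \<Longrightarrow> 2 * c * (1/2)^n < e"
      by (auto simp: eventually_sequentially)
    show "\<exists>N. \<forall>n n'. N \<le> n \<longrightarrow> N \<le> n' \<longrightarrow> inv_dist (y n) (y n') < e"
    proof (intro exI[of _ "max m N"] allI impI)
      fix n n' assume *: "max m N \<le> n" "max m N \<le> n'"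
      show "inv_dist (y n) (y n') < e"
      proof (cases "n \<le> n'")
        case True
        then show ?thesis using bound'[of n n'] N[of n] *
          by (simp add: inv_dist_eq fnorm_diff_commute[of "y n"])
      next
        case False
        then show ?thesis using bound'[of n' n] N[of n'] *
          by (simp add: inv_dist_eq)
      qed
    qed
  qed auto
  then obtain l where "limitin (Metric_space.mtopology UNIV inv_dist) y l sequentially"
    using inv_dist(2) unfolding Metric_space.mcomplete_def[OF inv_dist(1)] by blast
  then have l: "y \<longlonglongrightarrow> l" by (simp add: inv_dist(3))
  have "(\<lambda>k. fnorm (y k - y m)) \<longlonglongrightarrow> fnorm (l - y m)"
    using l by (intro tendsto_fnorm tendsto_diff tendsto_const)
  then have "fnorm (l - y m) \<le> 2 * c * (1/2)^m"
    by (rule LIMSEQ_le_const2) (use bound' in auto)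
  then show ?thesis using l by blast
qed

text \<open>\<open>p\<close> is the Minkowski gauge of a convex open neighbourhood of
  \<open>0\<close> that misses \<open>x0\<close>. The neighbourhood need not be symmetric, so
  \<open>p\<close> is only positively homogeneous; it takes the place of a continuous functional
  that detects \<open>x0\<close>.\<close>

lemma ex_sublinear:
  assumes "x0 \<noteq> 0"
  obtains p :: "'a \<Rightarrow> real" where
    "\<And>y. 0 \<le> p y" "\<And>y z. p (y + z) \<le> p y + p z" "\<And>t y. 0 \<le> t \<Longrightarrow> p (smul t y) = t * p y"
    "\<And>f l. f \<longlonglongrightarrow> l \<Longrightarrow> (\<lambda>n. p (f n)) \<longlonglongrightarrow> p l" "0 < p x0"
proof -
  have "continuous_on UNIV fnorm"
    unfolding continuous_on_def by (auto intro!: tendsto_fnorm)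
  then have "open {y. fnorm y < fnorm x0}"
    by (intro open_Collect_less continuous_on_const)
  moreover have "0 < fnorm x0" using assms by (simp add: less_le)
  ultimately obtain V where V: "open V" "0 \<in> V" "V \<subseteq> {y. fnorm y < fnorm x0}" "convex_wrt smul V"
    using locally_convex[of "{y. fnorm y < fnorm x0}"] by auto
  have x0: "x0 \<notin> V" using V(3) by auto
  have conv: "smul (1 - t) y + smul t z \<in> V" if "y \<in> V" "z \<in> V" "0 \<le> t" "t \<le> 1" for y z t
    using V(4) that unfolding convex_wrt_def by (metis of_real_eq_id id_apply)
  \<comment> \<open>\<open>t\<close> lies in \<open>K y\<close> when \<open>y\<close> belongs to the
    dilate of \<open>V\<close> by \<open>t\<close>; convexity of \<open>V\<close> becomes
    \<open>K_sum\<close>, and the gauge is the infimum of these factors.\<close>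
  define K where "K y = {t. 0 < t \<and> smul (1/t) y \<in> V}" for y
  define p where "p y = Inf (K y)" for y
  have K_sum: "s + t \<in> K (y + z)" if "s \<in> K y" "t \<in> K z" for s t y z
  proof -
    have st: "s > 0" "t > 0" using that by (auto simp: K_def)
    have "1 - t/(s+t) = s/(s+t)" using st by (simp add: field_simps)
    then have "smul (s/(s+t)) (smul (1/s) y) + smul (t/(s+t)) (smul (1/t) z) \<in> V"
      using conv[of "smul (1/s) y" "smul (1/t) z" "t/(s+t)"] that st by (simp add: K_def)
    then show ?thesis using st by (simp add: K_def scale_right_distrib)
  qed
  have K_0: "t \<in> K 0" if "t > 0" for t using that V(2) by (simp add: K_def)
  have K_up: "t \<in> K y" if "s \<in> K y" "s \<le> t" for s t y
    using K_sum[OF that(1) K_0, of "t - s"] that by (cases "s = t") auto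
  have small: "eventually (\<lambda>n. e \<in> K (f n)) sequentially" if "f \<longlonglongrightarrow> 0" "e > 0" for f :: "nat \<Rightarrow> 'a" and e
  proof -
    have "(\<lambda>n. smul (1/e) (f n)) \<longlonglongrightarrow> smul (1/e) 0"
      by (intro tendsto_smul tendsto_const that)
    then have "eventually (\<lambda>n. smul (1/e) (f n) \<in> V) sequentially"
      by (rule topological_tendstoD) (use V in auto)
    then show ?thesis using that by (simp add: K_def)
  qed
  have K_ne: "\<exists>t. t \<in> K y" for y
  proof -
    have "(\<lambda>n. smul (inverse (real (Suc n))) y) \<longlonglongrightarrow> smul 0 y"
      by (intro tendsto_smul tendsto_const LIMSEQ_inverse_real_of_nat)
    then have "eventually (\<lambda>n. smul (inverse (real (Suc n))) y \<in> V) sequentially"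
      by (rule topological_tendstoD) (use V in auto)
    then obtain n where "smul (inverse (real (Suc n))) y \<in> V"
      unfolding eventually_sequentially by blast
    then have "real (Suc n) \<in> K y" by (simp add: K_def inverse_eq_divide)
    then show ?thesis by blast
  qed
  have bdd: "bdd_below (K y)" for y by (rule bdd_belowI[of _ 0]) (simp add: K_def)
  have p_le: "p y \<le> t" if "t \<in> K y" for y t
    unfolding p_def using that bdd by (rule cInf_lower)
  have p_ge: "c \<le> p y" if "\<And>t. t \<in> K y \<Longrightarrow> c \<le> t" for y c
    unfolding p_def by (rule cInf_greatest) (use K_ne that in auto)
  have p_nonneg: "0 \<le> p y" for y by (rule p_ge) (simp add: K_def)
  have p_add: "p (y + z) \<le> p y + p z" for y z
  proof -
    have "p (y + z) - t \<le> p y" if "t \<in> K z" for t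
      by (rule p_ge) (use p_le[OF K_sum[OF _ that]] in \<open>simp add: algebra_simps\<close>)
    then have "p (y + z) - p y \<le> p z"
      by (intro p_ge) (simp add: algebra_simps)
    then show ?thesis by simp
  qed
  have p_scale_le: "p (smul t y) \<le> t * p y" if "t > 0" for t y
  proof -
    have "p (smul t y) / t \<le> p y"
    proof (rule p_ge)
      fix s assume "s \<in> K y"
      then have "t * s \<in> K (smul t y)" using that by (simp add: K_def)
      then show "p (smul t y) / t \<le> s" using p_le that by (simp add: field_simps)
    qed
    then show ?thesis using that by (simp add: field_simps)
  qed
  have "p 0 \<le> 0" by (rule field_le_epsilon) (simp add: p_le[OF K_0])
  then have p_0: "p 0 = 0" using p_nonneg[of 0] by simp
  have p_scale: "p (smul t y) = t * p y" if "0 \<le> t" for t y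
  proof (cases "t = 0")
    case True
    then show ?thesis by (simp add: p_0)
  next
    case False
    then have "t * p (smul (1/t) (smul t y)) \<le> p (smul t y)"
      using p_scale_le[of "1/t" "smul t y"] that by (simp add: field_simps)
    then show ?thesis using p_scale_le[of t y] False that by simp
  qed
  have p_lim0: "(\<lambda>n. p (f n)) \<longlonglongrightarrow> 0" if "f \<longlonglongrightarrow> 0" for f :: "nat \<Rightarrow> 'a"
  proof (rule order_tendstoI)
    show "eventually (\<lambda>n. a < p (f n)) sequentially" if "a < 0" for a
      using that p_nonneg by (simp add: less_le_trans)
    fix a :: real assume "0 < a"
    then have "eventually (\<lambda>n. a/2 \<in> K (f n)) sequentially" by (intro small that) simp
    then show "eventually (\<lambda>n. p (f n) < a) sequentially"
      using \<open>0 < a\<close> by (auto elim!: eventually_mono dest!: p_le)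
  qed
  have p_cont: "(\<lambda>n. p (f n)) \<longlonglongrightarrow> p l" if f: "f \<longlonglongrightarrow> l" for f :: "nat \<Rightarrow> 'a" and l
  proof -
    \<comment> \<open>Differences of both signs are needed, since \<open>p\<close> need not be
      even.\<close>
    have 0: "(\<lambda>n. f n - l) \<longlonglongrightarrow> 0" "(\<lambda>n. l - f n) \<longlonglongrightarrow> 0"
      using tendsto_diff[OF f tendsto_const, of l] tendsto_diff[OF tendsto_const f, of l] by simp_all
    have 1: "(\<lambda>n. p (f n - l) + p (l - f n)) \<longlonglongrightarrow> 0"
      using tendsto_add[OF p_lim0[OF 0(1)] p_lim0[OF 0(2)]] by simp
    have "\<bar>p (f n) - p l\<bar> \<le> p (f n - l) + p (l - f n)" for n
      using p_add[of "f n - l" l] p_add[of "l - f n" "f n"] p_nonneg[of "f n - l"]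
        p_nonneg[of "l - f n"] by simp
    then have "(\<lambda>n. p (f n) - p l) \<longlonglongrightarrow> 0"
      by (intro Lim_null_comparison[OF _ 1]) auto
    then show ?thesis by (simp add: LIM_zero_iff)
  qed
  have "1 \<le> t" if "t \<in> K x0" for t
    using K_up[OF that, of 1] x0 by (force simp: K_def)
  then have "1 \<le> p x0" by (rule p_ge)
  then show thesis using that[of p] p_nonneg p_add p_scale p_cont by simp
qed

end

section \<open>Irreducible families of operators\<close>

text \<open>The composition of \<open>b i\<close> over \<open>j \<le> i < k\<close>, larger indices
  on the left, and \<open>id\<close> for an empty range. The lower end \<open>j\<close> is variable
  because the tails of an infinite product are estimated separately.\<close>

primrec subprod :: "(nat \<Rightarrow> 'a \<Rightarrow> 'a) \<Rightarrow> nat \<Rightarrow> nat \<Rightarrow> 'a \<Rightarrow> 'a" where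
  "subprod b j 0 = id"
| "subprod b j (Suc k) = (if j \<le> k then b k \<circ> subprod b j k else id)"

lemma subprod_self [simp]: "subprod b j j = id"
  by (cases j) auto

lemma subprod_cong: "(\<And>i. i < k \<Longrightarrow> b i = c i) \<Longrightarrow> subprod b j k = subprod c j k"
  by (induction k) auto

lemma subprod_split: "j \<le> k \<Longrightarrow> subprod b 0 k = subprod b j k \<circ> subprod b 0 j"
  by (induction k rule: dec_induct) (auto simp: o_assoc)

text \<open>Lying in \<open>A\<close> makes \<open>T\<close> commute with the whole commutant of
  \<open>A\<close>, and commuting with \<open>A\<close> puts \<open>T\<close> into that commutant;
  together this makes \<open>T\<close> central.\<close>

locale irreducible_ops = real_frechet_space smul
  for smul :: "real \<Rightarrow> 'a::topological_ab_group_add \<Rightarrow> 'a" +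
  fixes A :: "('a \<Rightarrow> 'a) set" and T :: "'a \<Rightarrow> 'a"
  assumes A_ops: "A \<subseteq> continuous_linear_ops smul"
    and T_in: "T \<in> A"
    and T_commutes: "S \<in> A \<Longrightarrow> S \<circ> T = T \<circ> S"
    and irreducible: "subspace M \<Longrightarrow> (\<And>S. S \<in> A \<Longrightarrow> S ` M \<subseteq> M) \<Longrightarrow> M = {0} \<or> M = UNIV"
begin

section \<open>The family \<open>A\<close>, its commutant and the centre of the commutant\<close>

lemma linear_smul_iff: "Vector_Spaces.linear smul smul f \<longleftrightarrow>
    (\<forall>y z. f (y + z) = f y + f z) \<and> (\<forall>c y. f (smul c y) = smul c (f y))"
  by (auto simp: linear_iff_module_hom module_hom_iff vector_space_axioms module_axioms)

lemma A_add: "S \<in> A \<Longrightarrow> S (y + z) = S y + S z"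
  and A_smul: "S \<in> A \<Longrightarrow> S (smul c y) = smul c (S y)"
  using A_ops by (auto simp: continuous_linear_ops_def linear_smul_iff)

lemma A_tendsto: "S \<in> A \<Longrightarrow> (f \<longlongrightarrow> l) F \<Longrightarrow> ((\<lambda>n. S (f n)) \<longlongrightarrow> S l) F"
  using A_ops continuous_on_tendsto_compose[of UNIV S f l F]
  by (auto simp: continuous_linear_ops_def)

lemma A_0: "S \<in> A \<Longrightarrow> S 0 = 0"
  using A_smul[of S 0 0] by simp

text \<open>The vectors with property \<open>P\<close> form an \<open>A\<close>-invariant subspace
  containing a nonzero vector. It serves as an induction rule that spreads a property from one
  vector to all.\<close>

lemma everywhere:
  assumes "x \<noteq> 0" "P x"
    and "P 0" "\<And>y z. P y \<Longrightarrow> P z \<Longrightarrow> P (y + z)" "\<And>c y. P y \<Longrightarrow> P (smul c y)"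
    and "\<And>S y. S \<in> A \<Longrightarrow> P y \<Longrightarrow> P (S y)"
  shows "P y"
proof -
  have "subspace {y. P y}" using assms by (auto simp: subspace_def)
  then have "{y. P y} = {0} \<or> {y. P y} = UNIV"
    using assms(6) by (intro irreducible) auto
  then show ?thesis using assms(1,2) by auto
qed

text \<open>Continuity is not demanded, so that inverses and pointwise limits stay in the commutant
  without further argument.\<close>

definition com :: "('a \<Rightarrow> 'a) \<Rightarrow> bool" where
  "com f \<longleftrightarrow> Vector_Spaces.linear smul smul f \<and> (\<forall>S\<in>A. \<forall>y. f (S y) = S (f y))"

text \<open>A central map passes through every member of the commutant; this replaces the continuity
  that those members may lack.\<close>

definition central :: "('a \<Rightarrow> 'a) \<Rightarrow> bool" where
  "central f \<longleftrightarrow> com f \<and> (\<forall>g y. com g \<longrightarrow> f (g y) = g (f y))"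

lemma comI:
  assumes "\<And>y z. f (y + z) = f y + f z" "\<And>c y. f (smul c y) = smul c (f y)"
    and "\<And>S y. S \<in> A \<Longrightarrow> f (S y) = S (f y)"
  shows "com f"
  using assms by (simp add: com_def linear_smul_iff)

lemma com_add: "com f \<Longrightarrow> f (y + z) = f y + f z"
  and com_smul: "com f \<Longrightarrow> f (smul c y) = smul c (f y)"
  and com_A: "com f \<Longrightarrow> S \<in> A \<Longrightarrow> f (S y) = S (f y)"
  by (simp_all add: com_def linear_smul_iff)

lemma com_0: "com f \<Longrightarrow> f 0 = 0"
  using com_smul[of f 0 0] by simp

lemma com_minus: "com f \<Longrightarrow> f (- y) = - f y"
  using com_add[of f y "- y"] com_0[of f] by (simp add: eq_neg_iff_add_eq_0 add.commute)

lemma com_diff: "com f \<Longrightarrow> f (y - z) = f y - f z"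
  using com_add[of f y "- z"] com_minus[of f z] by simp

lemma central_com: "central f \<Longrightarrow> com f"
  by (simp add: central_def)

lemma central_commute: "central f \<Longrightarrow> com g \<Longrightarrow> f (g y) = g (f y)"
  by (simp add: central_def)

lemma com_id: "com id"
  by (rule comI) simp_all

lemma com_zero: "com (\<lambda>y. 0)"
  by (rule comI) (simp_all add: A_0)

lemma com_comp:
  assumes "com f" "com g" shows "com (f \<circ> g)"
  by (rule comI) (simp_all add: com_add[OF assms(1)] com_add[OF assms(2)] com_smul[OF assms(1)]
      com_smul[OF assms(2)] com_A[OF assms(1)] com_A[OF assms(2)])

lemma com_plus:
  assumes "com f" "com g" shows "com (\<lambda>y. f y + g y)"
  by (rule comI) (simp_all add: com_add[OF assms(1)] com_add[OF assms(2)] com_smul[OF assms(1)]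
      com_smul[OF assms(2)] com_A[OF assms(1)] com_A[OF assms(2)] A_add scale_right_distrib)

lemma com_scaled:
  assumes "com f" shows "com (\<lambda>y. smul c (f y))"
  by (rule comI) (simp_all add: com_add[OF assms] com_smul[OF assms] com_A[OF assms] A_smul
      scale_right_distrib mult.commute)

lemma centralI: "com f \<Longrightarrow> (\<And>g y. com g \<Longrightarrow> f (g y) = g (f y)) \<Longrightarrow> central f"
  by (simp add: central_def)

lemma central_id: "central id"
  by (rule centralI) (simp_all add: com_id)

lemma central_zero: "central (\<lambda>y. 0)"
  by (rule centralI) (simp_all only: com_zero com_0)

lemma central_comp: "central f \<Longrightarrow> central g \<Longrightarrow> central (f \<circ> g)"
  by (rule centralI) (simp_all add: com_comp central_com central_commute)

lemma central_plus: "central f \<Longrightarrow> central g \<Longrightarrow> central (\<lambda>y. f y + g y)"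
  by (rule centralI) (simp_all only: com_plus central_com central_commute com_add)

lemma central_scaled: "central f \<Longrightarrow> central (\<lambda>y. smul c (f y))"
  by (rule centralI) (simp_all only: com_scaled central_com central_commute com_smul)

lemma central_diff: "central f \<Longrightarrow> central g \<Longrightarrow> central (\<lambda>y. f y - g y)"
  using central_plus[OF _ central_scaled[of g "-1"], of f] by simp

lemma central_T: "central T"
  unfolding central_def
proof (intro conjI allI impI)
  show "com T"
  proof (rule comI)
    show "T (S y) = S (T y)" if "S \<in> A" for S y
      using T_commutes[OF that] by (metis comp_apply)
  qed (simp_all only: A_add[OF T_in] A_smul[OF T_in])
  show "T (g y) = g (T y)" if "com g" for g y
    by (rule com_A[OF that T_in, symmetric])
qed

text \<open>Schur's lemma: the kernel and the range of \<open>f\<close> are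
  \<open>A\<close>-invariant subspaces, and \<open>f x \<noteq> 0\<close> rules out the wrong
  alternative for each.\<close>

lemma com_cases: "com f \<Longrightarrow> f x \<noteq> 0 \<Longrightarrow> bij f"
proof -
  assume f: "com f" and x: "f x \<noteq> 0"
  have x0: "x \<noteq> 0" using x com_0[OF f] by auto
  have "y = 0" if "f y = 0" for y
  proof (rule ccontr)
    assume "y \<noteq> 0"
    then have "f x = 0"
      by (rule everywhere[where P = "\<lambda>y. f y = 0"])
        (use that f in \<open>auto simp: com_0 com_add com_smul com_A A_0\<close>)
    then show False using x by simp
  qed
  then have "inj f" by (metis com_diff[OF f] eq_iff_diff_eq_0 injI)
  moreover have "\<exists>z. y = f z" for y
  proof (rule everywhere[OF x, where P = "\<lambda>y. \<exists>z. y = f z"])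
    show "\<exists>w. y + z = f w" if "\<exists>w. y = f w" "\<exists>w. z = f w" for y z
      using that com_add[OF f] by metis
    show "\<exists>w. smul c y = f w" if "\<exists>w. y = f w" for c y
      using that com_smul[OF f] by metis
    show "\<exists>w. S y = f w" if "S \<in> A" "\<exists>w. y = f w" for S y
      using that com_A[OF f] by metis
  qed (use com_0[OF f] in metis)+
  ultimately show "bij f" by (auto simp: bij_def surj_def)
qed

lemma com_inv:
  assumes f: "com f" and "bij f" shows "com (inv f)"
proof -
  have inv_f: "inv f (f y) = y" "f (inv f y) = y" for y
    using \<open>bij f\<close> by (simp_all add: bij_is_inj bij_is_surj surj_f_inv_f)
  have eqI: "inv f y = z" if "y = f z" for y z using that inv_f by simp
  show ?thesis
    by (rule comI; rule eqI) (auto simp: com_add[OF f] com_smul[OF f] com_A[OF f] inv_f)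
qed

lemma central_inv:
  assumes f: "central f" and "bij f" shows "central (inv f)"
proof -
  have inv_f: "inv f (f y) = y" "f (inv f y) = y" for y
    using \<open>bij f\<close> by (simp_all add: bij_is_inj bij_is_surj surj_f_inv_f)
  have "inv f (g y) = g (inv f y)" if "com g" for g y
    using central_commute[OF f that, of "inv f y"] inv_f by metis
  then show ?thesis using com_inv[OF central_com[OF f] \<open>bij f\<close>] by (simp add: central_def)
qed

section \<open>Pointwise limits in the commutant\<close>

lemma com_limit:
  assumes f: "\<And>n::nat. com (f n)" and lim: "\<And>y. (\<lambda>n. f n y) \<longlonglongrightarrow> g y"
  shows "com g"
proof (rule comI)
  show "g (y + z) = g y + g z" for y z
    by (rule limit_unique[OF lim[of "y + z"]])
      (auto simp: com_add[OF f] intro!: tendsto_add lim)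
  show "g (smul c y) = smul c (g y)" for c y
    by (rule limit_unique[OF lim[of "smul c y"]])
      (auto simp: com_smul[OF f] intro!: tendsto_smul lim)
  show "g (S y) = S (g y)" if "S \<in> A" for S y
    by (rule limit_unique[OF lim[of "S y"]])
      (auto simp: com_A[OF f that] intro!: A_tendsto[OF that] lim)
qed

text \<open>The vectors at which a given sequence in the commutant of \<open>A\<close> converges form an
  \<open>A\<close>-invariant linear manifold; hence convergence at one nonzero vector propagates.\<close>
lemma com_tendsto_id:
  assumes f: "\<And>n::nat. com (f n)" and "x \<noteq> 0" "(\<lambda>n. f n x) \<longlonglongrightarrow> x"
  shows "(\<lambda>n. f n y) \<longlonglongrightarrow> y"
proof (rule everywhere[OF assms(2), where P = "\<lambda>y. (\<lambda>n. f n y) \<longlonglongrightarrow> y"])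
  show "(\<lambda>n. f n (S y)) \<longlonglongrightarrow> S y" if "S \<in> A" "(\<lambda>n. f n y) \<longlonglongrightarrow> y" for S y
    unfolding com_A[OF f that(1)] by (rule A_tendsto[OF that])
qed (simp_all add: assms(3) com_0[OF f] com_add[OF f] com_smul[OF f]
      tendsto_add tendsto_smul[OF tendsto_const])

lemma com_convergent:
  assumes f: "\<And>n::nat. com (f n)" and "x \<noteq> 0" "(\<lambda>n. f n x) \<longlonglongrightarrow> l"
  obtains g where "com g" "\<And>y. (\<lambda>n. f n y) \<longlonglongrightarrow> g y"
proof -
  have "\<exists>l. (\<lambda>n. f n y) \<longlonglongrightarrow> l" for y
  proof (rule everywhere[OF assms(2), where P = "\<lambda>y. \<exists>l. (\<lambda>n. f n y) \<longlonglongrightarrow> l"])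
    fix S y z c
    assume "\<exists>l. (\<lambda>n. f n y) \<longlonglongrightarrow> l"
    then obtain l where l: "(\<lambda>n. f n y) \<longlonglongrightarrow> l" by blast
    show "\<exists>l. (\<lambda>n. f n (smul c y)) \<longlonglongrightarrow> l"
      unfolding com_smul[OF f] using tendsto_smul[OF tendsto_const l] by (rule exI)
    show "\<exists>l. (\<lambda>n. f n (S y)) \<longlonglongrightarrow> l" if "S \<in> A"
      unfolding com_A[OF f that] using A_tendsto[OF that l] by (rule exI)
    assume "\<exists>l. (\<lambda>n. f n z) \<longlonglongrightarrow> l"
    then obtain m where m: "(\<lambda>n. f n z) \<longlonglongrightarrow> m" by blast
    show "\<exists>l. (\<lambda>n. f n (y + z)) \<longlonglongrightarrow> l"
      unfolding com_add[OF f] using tendsto_add[OF l m] by (rule exI)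
  qed (use assms(3) in \<open>auto simp: com_0[OF f]\<close>)
  then obtain g where g: "\<And>y. (\<lambda>n. f n y) \<longlonglongrightarrow> g y" by metis
  then show thesis using that com_limit[OF f g] by blast
qed

section \<open>Infinite products of central maps and continuity of inversion\<close>

lemma subprod_central: "(\<And>n. central (b n)) \<Longrightarrow> central (subprod b j k)"
  by (induction k) (auto simp: central_id central_comp)

lemma subprod_bij: "(\<And>n. bij (b n)) \<Longrightarrow> bij (subprod b j k)"
  by (induction k) (auto intro: bij_comp)

text \<open>Let \<open>v j\<close> be the limit of the tail products starting at \<open>j\<close>.
  The choice of \<open>s\<close> forces \<open>v j\<close> to tend to the identity, and
  \<open>v 0\<close> is a finite product composed with \<open>v j\<close>. Hence
  \<open>u = v 0\<close> is nonzero, so bijective, and the inverse of the finite product is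
  \<open>v j\<close> after \<open>inv u\<close>.\<close>

lemma convergent_subproduct:
  assumes b: "\<And>n. central (b n)" "\<And>n. bij (b n)" "\<And>y. (\<lambda>n. b n y) \<longlonglongrightarrow> y"
    and x: "(x::'a) \<noteq> 0"
  obtains s u where "strict_mono s" "com u" "bij u"
    "\<And>y. (\<lambda>k. subprod (b \<circ> s) 0 k y) \<longlonglongrightarrow> u y"
    "\<And>y. (\<lambda>k. inv (subprod (b \<circ> s) 0 k) y) \<longlonglongrightarrow> inv u y"
proof -
  \<comment> \<open>The demand is made for every start \<open>j \<le> k\<close> at once, so that
    each tail product converges at \<open>x\<close> with an error of at most
    \<open>2 * (1/2)^j\<close>.\<close>
  define P where "P k s n \<longleftrightarrow> (\<forall>j\<in>{..k}. fnorm (b n (subprod (b \<circ> s) j k x) - subprod (b \<circ> s) j k x) < (1/2)^k)"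
    for k :: nat and s n
  have "\<exists>s. strict_mono s \<and> (\<forall>k. P k s (s k))"
  proof (rule subsequence_choice)
    fix k :: nat and s :: "nat \<Rightarrow> nat"
    have "eventually (\<lambda>n. fnorm (b n z - z) < (1/2)^k) sequentially" for z
      using b(3)[of z] by (auto simp: tendsto_fnorm_iff intro: order_tendstoD(2))
    then show "eventually (P k s) sequentially"
      unfolding P_def by (intro eventually_ball_finite) auto
  next
    fix k n :: nat and s t :: "nat \<Rightarrow> nat"
    assume "\<And>i. i < k \<Longrightarrow> s i = t i" "P k s n"
    moreover from this have "subprod (b \<circ> s) j k = subprod (b \<circ> t) j k" for j
      by (intro subprod_cong) auto
    ultimately show "P k t n" by (simp add: P_def)
  qed
  then obtain s where s: "strict_mono s" "\<And>k. P k s (s k)" by blast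
  define c where "c = b \<circ> s"
  have c: "\<And>n. central (c n)" "\<And>n. bij (c n)" by (simp_all add: c_def b)
  note subprod_c_central = subprod_central[of c, OF c(1)]
  note subprod_c_bij = subprod_bij[of c, OF c(2)]
  note cc = subprod_c_central[THEN central_com]
  have ex: "\<exists>l. (\<lambda>k. subprod c j k x) \<longlonglongrightarrow> l \<and> fnorm (l - x) \<le> 2 * (1/2)^j" for j
  proof -
    have "fnorm (subprod c j (Suc k) x - subprod c j k x) \<le> 1 * (1/2)^k" if "j \<le> k" for k
      using s(2)[of k] that by (auto simp: P_def c_def intro: less_imp_le)
    from geometric_convergence[of j "\<lambda>k. subprod c j k x", OF this] show ?thesis by simp
  qed
  have "\<exists>v. com v \<and> (\<forall>y. (\<lambda>k. subprod c j k y) \<longlonglongrightarrow> v y) \<and> fnorm (v x - x) \<le> 2 * (1/2)^j" for j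
  proof -
    obtain l where l: "(\<lambda>k. subprod c j k x) \<longlonglongrightarrow> l" "fnorm (l - x) \<le> 2 * (1/2)^j" using ex by blast
    obtain v where "com v" "\<And>y. (\<lambda>k. subprod c j k y) \<longlonglongrightarrow> v y"
      using com_convergent[OF cc x l(1)] by blast
    then show ?thesis using l limit_unique[OF l(1)] by (metis sequentially_bot)
  qed
  then obtain v where v: "\<And>j. com (v j)" "\<And>j y. (\<lambda>k. subprod c j k y) \<longlonglongrightarrow> v j y"
    "\<And>j. fnorm (v j x - x) \<le> 2 * (1/2)^j" by metis
  have pow0: "(\<lambda>j. 2 * (1/2)^j) \<longlonglongrightarrow> (0::real)"
    using tendsto_mult[OF tendsto_const LIMSEQ_power_zero, of "1/2::real" "2::real"] by simp
  have "(\<lambda>j. v j x) \<longlonglongrightarrow> x"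
    unfolding tendsto_fnorm_iff
    by (rule Lim_null_comparison[OF _ pow0]) (use v(3) in auto)
  then have v_id: "(\<lambda>j. v j y) \<longlonglongrightarrow> y" for y
    by (rule com_tendsto_id[OF v(1) x])
  have v0: "v 0 y = subprod c 0 j (v j y)" for j y
  proof -
    have "eventually (\<lambda>k. subprod c 0 k y = subprod c j k (subprod c 0 j y)) sequentially"
      by (rule eventually_sequentiallyI[of j]) (subst subprod_split[of j], simp_all)
    then have "(\<lambda>k. subprod c j k (subprod c 0 j y)) \<longlonglongrightarrow> v 0 y"
      by (rule Lim_transform_eventually[OF v(2)[of 0 y]])
    then have "v 0 y = v j (subprod c 0 j y)" using v(2) by (rule limit_unique) simp
    also have "\<dots> = subprod c 0 j (v j y)"
      by (rule central_commute[OF subprod_c_central v(1), symmetric])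
    finally show ?thesis .
  qed
  obtain J where "v J x \<noteq> 0"
  proof -
    have "eventually (\<lambda>j. fnorm (v j x) > 0) sequentially"
      by (rule order_tendstoD(1)[OF tendsto_fnorm[OF v_id[of x]]]) (use x in \<open>simp add: less_le\<close>)
    then obtain j where "fnorm (v j x) > 0" unfolding eventually_sequentially by blast
    then show thesis by (intro that[of j]) auto
  qed
  \<comment> \<open>\<open>v 0 x\<close> is the image of \<open>v J x\<close> under an injective
    finite product.\<close>
  then have "v 0 x \<noteq> 0"
    using inj_eq[OF bij_is_inj[OF subprod_c_bij[of 0 J]], of "v J x" 0] com_0[OF cc, of 0 J]
    by (simp add: v0[of x J])
  then have bij: "bij (v 0)" using com_cases[OF v(1)] by blast
  have "inv (subprod c 0 j) y = v j (inv (v 0) y)" for j y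
  proof (rule inv_f_eq[OF bij_is_inj[OF subprod_c_bij]])
    show "subprod c 0 j (v j (inv (v 0) y)) = y"
      by (rule trans[OF v0[symmetric] surj_f_inv_f[OF bij_is_surj[OF bij]]])
  qed
  then have inv_lim: "(\<lambda>k. inv (subprod c 0 k) y) \<longlonglongrightarrow> inv (v 0) y" for y
    by (simp only: v_id)
  show thesis
    by (rule that[OF s(1) v(1) bij]) (fold c_def, rule v(2), rule inv_lim)
qed

text \<open>If \<open>w\<^sub>n a\<^sub>n x\<close> stayed away from \<open>0\<close>, form \<open>s = \<Sum> a\<^sub>j\<close> over the even indices of a sparse
  subsequence. Then \<open>w\<^sub>k a\<^sub>k x\<close> (for even \<open>k\<close>, and \<open>0\<close> for odd \<open>k\<close>) converges to
  \<open>w s x - s w x\<close>, and the odd indices force this limit to vanish.\<close>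
lemma gliding_hump:
  assumes a: "\<And>n. central (a n)" "\<And>y. (\<lambda>n. a n y) \<longlonglongrightarrow> 0"
    and w: "\<And>n. central (w n)" "com wl" "\<And>y. (\<lambda>n. w n y) \<longlonglongrightarrow> wl y"
    and x: "x \<noteq> 0" and e: "e > 0"
  shows "\<exists>n::nat. fnorm (w n (a n x)) < e"
proof (rule ccontr)
  assume "\<not> ?thesis"
  then have far: "fnorm (w n (a n x)) \<ge> e" for n by (auto simp: not_less)
  define t where "t s k y = (\<Sum>j<k. if even j then a (s j) y else 0)" for s :: "nat \<Rightarrow> nat" and k y
  have tS: "t s (Suc k) y = t s k y + (if even k then a (s k) y else 0)" for s k y
    by (simp add: t_def)
  \<comment> \<open>The first clause makes the series converge at \<open>x\<close>; the second makes
    its tail after index \<open>j\<close> small at \<open>w (s j) x\<close>; the third lets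
    \<open>w\<close> be replaced by \<open>wl\<close> at the partial sum fixed so far.\<close>
  define P where "P k s n \<longleftrightarrow> fnorm (a n x) < (1/2)^k \<and>
      (\<forall>j\<in>{..<k}. fnorm (a n (w (s j) x)) < (1/2)^k) \<and>
      fnorm (w n (t s k x) - wl (t s k x)) < (1/2)^k" for k :: nat and s n
  have "\<exists>s. strict_mono s \<and> (\<forall>k. P k s (s k))"
  proof (rule subsequence_choice)
    fix k :: nat and s :: "nat \<Rightarrow> nat"
    have 1: "eventually (\<lambda>n. fnorm (a n z) < (1/2)^k) sequentially" for z
      using a(2)[of z] by (auto simp: tendsto_fnorm_0 intro: order_tendstoD(2))
    have 2: "eventually (\<lambda>n. fnorm (w n z - wl z) < (1/2)^k) sequentially" for z
      using w(3)[of z] by (auto simp: tendsto_fnorm_iff intro: order_tendstoD(2))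
    show "eventually (P k s) sequentially"
      unfolding P_def by (intro eventually_conj eventually_ball_finite ballI 1 2) auto
  next
    fix k n :: nat and s s' :: "nat \<Rightarrow> nat"
    assume *: "\<And>i. i < k \<Longrightarrow> s i = s' i" "P k s n"
    from *(1) have "t s k = t s' k" unfolding t_def by (intro ext sum.cong) auto
    then show "P k s' n" using * by (simp add: P_def)
  qed
  then obtain s where s: "strict_mono s" "\<And>k. P k s (s k)" by blast
  have t_central: "central (t s k)" for k
  proof (induction k)
    case 0
    then show ?case using central_zero by (simp add: t_def)
  next
    case (Suc k)
    have "t s (Suc k) = (\<lambda>y. t s k y + (if even k then a (s k) else (\<lambda>y. 0)) y)"
      by (simp add: tS fun_eq_iff)
    then show ?case using central_plus[OF Suc, of "if even k then a (s k) else (\<lambda>y. 0)"]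
      by (simp add: a central_zero)
  qed
  have "fnorm (t s (Suc k) x - t s k x) \<le> 1 * (1/2)^k" for k
    using s(2)[of k] by (auto simp: tS P_def intro: less_imp_le)
  from geometric_convergence[of 0 "\<lambda>k. t s k x", OF this] obtain l where "(\<lambda>k. t s k x) \<longlonglongrightarrow> l"
    by blast
  then obtain S where S: "com S" "\<And>y. (\<lambda>k. t s k y) \<longlonglongrightarrow> S y"
    using com_convergent[where f = "t s", OF central_com[OF t_central] x] by blast
  define D where "D k = (if even k then w (s k) (a (s k) x) else 0)" for k
  \<comment> \<open>By centrality \<open>E k\<close> is the tail of the series after index
    \<open>k\<close>, evaluated at \<open>w (s k) x\<close>; the second clause of \<open>P\<close>
    bounds it.\<close>
  define E where "E k = w (s k) (S x) - w (s k) (t s k x) - D k" for k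
  have "fnorm (E k) \<le> (1/2)^k" for k
  proof -
    have "fnorm (t s (Suc m) (w (s k) x) - t s m (w (s k) x)) \<le> 1 * (1/2)^m" if "Suc k \<le> m" for m
      using s(2)[of m] that by (auto simp: tS P_def intro: less_imp_le)
    from geometric_convergence[of "Suc k" "\<lambda>m. t s m (w (s k) x)", OF this]
    obtain l where l: "(\<lambda>m. t s m (w (s k) x)) \<longlonglongrightarrow> l"
      "fnorm (l - t s (Suc k) (w (s k) x)) \<le> (1/2)^k" by auto
    have "l = S (w (s k) x)" using l(1) S(2) by (rule limit_unique) simp
    then have "E k = l - t s (Suc k) (w (s k) x)"
      using central_commute[OF w(1) S(1)] central_commute[OF w(1) central_com[OF t_central]]
        central_commute[OF w(1) central_com[OF a(1)]]
      by (simp add: E_def D_def tS)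
    then show ?thesis using l by simp
  qed
  then have E0: "E \<longlonglongrightarrow> 0"
    unfolding tendsto_fnorm_0
    by (intro Lim_null_comparison[OF _ LIMSEQ_power_zero[of "1/2::real"]]) auto
  have w_lim: "(\<lambda>k. w (s k) (S x)) \<longlonglongrightarrow> wl (S x)"
    using LIMSEQ_subseq_LIMSEQ[OF w(3) s(1)] by (simp add: o_def)
  have "(\<lambda>k. w (s k) (t s k x) - wl (t s k x)) \<longlonglongrightarrow> 0"
    unfolding tendsto_fnorm_0
    by (rule Lim_null_comparison[OF _ LIMSEQ_power_zero[of "1/2::real"]])
      (use s(2) in \<open>auto simp: P_def intro!: always_eventually less_imp_le\<close>)
  \<comment> \<open>\<open>wl\<close> is not known to be continuous. Since the partial sums are
    central, \<open>wl\<close> moves inside them and the limit is taken at the fixed vector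
    \<open>wl x\<close>.\<close>
  moreover have "(\<lambda>k. wl (t s k x)) \<longlonglongrightarrow> S (wl x)"
    using S(2)[of "wl x"] by (simp add: central_commute[OF t_central w(2)])
  ultimately have "(\<lambda>k. w (s k) (t s k x) - wl (t s k x) + wl (t s k x)) \<longlonglongrightarrow> 0 + S (wl x)"
    by (rule tendsto_add)
  then have "(\<lambda>k. w (s k) (S x) - w (s k) (t s k x) - E k) \<longlonglongrightarrow> wl (S x) - S (wl x) - 0"
    by (intro tendsto_diff w_lim E0) simp
  then have D: "D \<longlonglongrightarrow> wl (S x) - S (wl x)"
    by (simp add: E_def)
  have "(\<lambda>k. D (2 * k + 1)) \<longlonglongrightarrow> wl (S x) - S (wl x)"
    using LIMSEQ_subseq_LIMSEQ[OF D, of "\<lambda>k. 2 * k + 1"] by (auto simp: o_def strict_mono_def)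
  then have "(\<lambda>k::nat. 0) \<longlonglongrightarrow> wl (S x) - S (wl x)" by (simp add: D_def)
  then have "wl (S x) - S (wl x) = 0" using tendsto_const by (rule limit_unique) simp
  then have "(\<lambda>k. D (2 * k)) \<longlonglongrightarrow> 0"
    using LIMSEQ_subseq_LIMSEQ[OF D, of "\<lambda>k. 2 * k"] by (auto simp: o_def strict_mono_def)
  then have "(\<lambda>k. fnorm (D (2 * k))) \<longlonglongrightarrow> 0" by (simp add: tendsto_fnorm_0)
  then have "e \<le> 0" by (rule LIMSEQ_le_const) (use far in \<open>auto simp: D_def\<close>)
  then show False using e by simp
qed

text \<open>Otherwise a subsequence \<open>c\<close> keeps its inverses away from \<open>y\<close>
  by \<open>e\<close>. With \<open>Q k\<close> the products of a convergent subproduct,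
  \<open>inv (c (s n)) y - y\<close> equals \<open>inv (Q (Suc n)) (Q n y - Q (Suc n) y)\<close>:
  converging maps applied to a null sequence of maps, which \<open>gliding_hump\<close> makes small
  for some \<open>n\<close>.\<close>

lemma inverse_tendsto_id:
  assumes b: "\<And>n. central (b n)" "\<And>n. bij (b n)" "\<And>y. (\<lambda>n. b n y) \<longlonglongrightarrow> y"
  shows "(\<lambda>n::nat. inv (b n) y) \<longlonglongrightarrow> y"
proof (cases "y = 0")
  case True
  then show ?thesis using com_0[OF com_inv[OF central_com[OF b(1)] b(2)]] by simp
next
  case False
  show ?thesis
  proof (rule ccontr)
    assume "\<not> ?thesis"
    then obtain e where e: "e > 0" "\<not> (\<forall>\<^sub>F n in sequentially. fnorm (inv (b n) y - y) < e)"
      by (auto simp: tendsto_fnorm_iff tendsto_iff)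
    then have "infinite {n. fnorm (inv (b n) y - y) \<ge> e}"
      by (metis (mono_tags, lifting) cofinite_eq_sequentially eventually_cofinite
          Collect_cong not_less)
    then obtain r :: "nat \<Rightarrow> nat" where r: "strict_mono r"
      "\<And>n. fnorm (inv (b (r n)) y - y) \<ge> e"
      using infinite_enumerate by (metis (mono_tags, lifting) mem_Collect_eq)
    define c where "c = b \<circ> r"
    have c: "\<And>n. central (c n)" "\<And>n. bij (c n)" by (simp_all add: c_def b)
    have c_lim: "(\<lambda>n. c n z) \<longlonglongrightarrow> z" for z
      using LIMSEQ_subseq_LIMSEQ[OF b(3) r(1)] by (simp add: o_def c_def)
    obtain s u where s: "strict_mono s" "com u" "bij u"
      "\<And>z. (\<lambda>k. subprod (c \<circ> s) 0 k z) \<longlonglongrightarrow> u z"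
      "\<And>z. (\<lambda>k. inv (subprod (c \<circ> s) 0 k) z) \<longlonglongrightarrow> inv u z"
      using convergent_subproduct[OF c c_lim False] by blast
    define Q where "Q k = subprod (c \<circ> s) 0 k" for k
    have Q: "central (Q k)" "bij (Q k)" for k
      unfolding Q_def by (auto intro!: subprod_central subprod_bij simp: c)
    have "\<exists>n. fnorm (inv (Q (Suc n)) (Q n y - Q (Suc n) y)) < e"
    proof (rule gliding_hump[where wl = "inv u" and a = "\<lambda>n y. Q n y - Q (Suc n) y"
          and w = "\<lambda>n. inv (Q (Suc n))"])
      show "central (\<lambda>y. Q n y - Q (Suc n) y)" for n
        by (intro central_diff Q)
      show "(\<lambda>n. Q n z - Q (Suc n) z) \<longlonglongrightarrow> 0" for z
        using tendsto_diff[OF s(4) LIMSEQ_Suc[OF s(4)], of z z] by (simp add: Q_def)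
      show "central (inv (Q (Suc n)))" for n by (intro central_inv Q)
      show "com (inv u)" by (intro com_inv s)
      show "(\<lambda>n. inv (Q (Suc n)) z) \<longlonglongrightarrow> inv u z" for z
        using LIMSEQ_Suc[OF s(5)] by (simp add: Q_def)
    qed (use False e in auto)
    then obtain n where n: "fnorm (inv (Q (Suc n)) (Q n y - Q (Suc n) y)) < e" by blast
    let ?z = "inv (c (s n)) y"
    \<comment> \<open>\<open>Q (Suc n)\<close> is \<open>Q n\<close> followed by the factor
      \<open>c (s n)\<close>, which centrality moves onto \<open>?z\<close>, where it cancels the
      inverse.\<close>
    have "Q (Suc n) ?z = Q n y"
      using central_commute[OF c(1) central_com[OF Q(1)], of "s n" n ?z] c(2)[of "s n"]
      by (simp add: Q_def bij_is_surj surj_f_inv_f)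
    then have "Q (Suc n) (?z - y) = Q n y - Q (Suc n) y"
      by (simp add: com_diff[OF central_com[OF Q(1)]])
    then have "inv (Q (Suc n)) (Q n y - Q (Suc n) y) = ?z - y"
      using Q(2)[of "Suc n"] by (metis bij_inv_eq_iff)
    then show False using n r(2)[of "s n"] by (simp add: c_def)
  qed
qed

end

section \<open>The resolvent of the complexification\<close>

locale nonquadratic_ops = irreducible_ops +
  assumes quad_nonzero: "\<exists>y. T (T y) + smul (- 2 * a) (T y) + smul (a\<^sup>2 + b\<^sup>2) y \<noteq> 0"
begin

text \<open>For \<open>l = a + i b\<close> this is the product of \<open>T - l\<close> and
  \<open>T - cnj l\<close>, which has real coefficients and therefore acts on the real
  space.\<close>

definition quad :: "real \<Rightarrow> real \<Rightarrow> 'a \<Rightarrow> 'a" where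
  "quad a b y = T (T y) + smul (- 2 * a) (T y) + smul (a\<^sup>2 + b\<^sup>2) y"

definition quad_inv :: "real \<Rightarrow> real \<Rightarrow> 'a \<Rightarrow> 'a" where
  "quad_inv a b = inv (quad a b)"

lemma quad_central: "central (quad a b)"
proof -
  have "central (\<lambda>y. (T \<circ> T) y + smul (- 2 * a) (T y) + smul (a\<^sup>2 + b\<^sup>2) (id y))"
    by (intro central_plus central_scaled central_comp central_T central_id)
  then show ?thesis by (simp add: quad_def[abs_def])
qed

lemma quad_bij: "bij (quad a b)"
proof -
  obtain y where "quad a b y \<noteq> 0" using quad_nonzero by (auto simp: quad_def)
  then show ?thesis using com_cases[OF central_com[OF quad_central]] by blast
qed

lemma quad_inv_central: "central (quad_inv a b)"
  unfolding quad_inv_def by (rule central_inv[OF quad_central quad_bij])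

lemma quad_inv_bij: "bij (quad_inv a b)"
  unfolding quad_inv_def by (rule bij_imp_bij_inv[OF quad_bij])

lemma quad_quad_inv [simp]: "quad a b (quad_inv a b y) = y"
  unfolding quad_inv_def by (rule surj_f_inv_f[OF bij_is_surj[OF quad_bij]])

lemmas T_add = A_add[OF T_in]
  and T_smul = A_smul[OF T_in]
  and T_tendsto = A_tendsto[OF T_in]
  and T_diff = com_diff[OF central_com[OF central_T]]
  and quad_inv_add = com_add[OF central_com[OF quad_inv_central]]
  and quad_inv_smul = com_smul[OF central_com[OF quad_inv_central]]
  and quad_inv_diff = com_diff[OF central_com[OF quad_inv_central]]

lemma quad_inv_T: "quad_inv a b (T y) = T (quad_inv a b y)"
  by (rule com_A[OF central_com[OF quad_inv_central] T_in])

text \<open>The coefficients of \<open>quad\<close> are continuous in \<open>a\<close> and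
  \<open>b\<close>, so \<open>quad (a n) (b n)\<close> after \<open>quad_inv a0 b0\<close> tends to
  the identity, and by \<open>inverse_tendsto_id\<close> so do the inverses.\<close>

lemma quad_inv_tendsto:
  assumes "a \<longlonglongrightarrow> a0" "b \<longlonglongrightarrow> b0"
  shows "(\<lambda>n::nat. quad_inv (a n) (b n) y) \<longlonglongrightarrow> quad_inv a0 b0 y"
proof -
  define c where "c n = quad (a n) (b n) \<circ> quad_inv a0 b0" for n
  have c_lim: "(\<lambda>n. c n z) \<longlonglongrightarrow> z" for z
  proof -
    have "(\<lambda>n. quad (a n) (b n) w) \<longlonglongrightarrow> quad a0 b0 w" for w
      unfolding quad_def
      by (intro tendsto_add tendsto_smul tendsto_mult tendsto_power tendsto_const assms)
    from this[of "quad_inv a0 b0 z"] show ?thesis by (simp add: c_def)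
  qed
  have "(\<lambda>n. inv (c n) (quad_inv a0 b0 y)) \<longlonglongrightarrow> quad_inv a0 b0 y"
    by (rule inverse_tendsto_id[OF _ _ c_lim]; unfold c_def)
      (intro central_comp quad_central quad_inv_central bij_comp quad_bij quad_inv_bij)+
  moreover have "inv (c n) (quad_inv a0 b0 y) = quad_inv (a n) (b n) y" for n
  proof (rule inv_f_eq)
    show "inj (c n)"
      unfolding c_def by (intro inj_compose bij_is_inj quad_bij quad_inv_bij)
    have "quad_inv a0 b0 (quad_inv (a n) (b n) y) = quad_inv (a n) (b n) (quad_inv a0 b0 y)"
      by (rule central_commute[OF quad_inv_central central_com[OF quad_inv_central]])
    then show "c n (quad_inv (a n) (b n) y) = quad_inv a0 b0 y" by (simp add: c_def)
  qed
  ultimately show ?thesis by simp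
qed

text \<open>Divided by \<open>r n\<close>, the squared modulus of \<open>a n + i b n\<close>,
  \<open>quad\<close> tends to the identity. Hence \<open>r n\<close> times \<open>quad_inv\<close>
  does so too, while the coefficients \<open>1 / r n\<close> and \<open>a n / r n\<close> that
  remain tend to \<open>0\<close>.\<close>

lemma quad_inv_at_infinity:
  assumes pos: "\<And>n. 0 < (a n)\<^sup>2 + (b n)\<^sup>2"
    and r0: "(\<lambda>n. 1 / ((a n)\<^sup>2 + (b n)\<^sup>2)) \<longlonglongrightarrow> 0"
    and a0: "(\<lambda>n. a n / ((a n)\<^sup>2 + (b n)\<^sup>2)) \<longlonglongrightarrow> 0"
  shows "(\<lambda>n::nat. T (quad_inv (a n) (b n) y) - smul (a n) (quad_inv (a n) (b n) y)) \<longlonglongrightarrow> 0"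
proof -
  define r where "r n = (a n)\<^sup>2 + (b n)\<^sup>2" for n
  have r: "r n \<noteq> 0" for n using pos[of n] by (simp only: r_def less_irrefl not_False_eq_True)
  note r0 = r0[folded r_def] and a0 = a0[folded r_def]
  define c where "c n z = smul (1 / r n) (quad (a n) (b n) z)" for n z
  have c_central: "central (c n)" for n
    unfolding c_def[abs_def] by (rule central_scaled[OF quad_central])
  have inv_c: "c n (smul (r n) (quad_inv (a n) (b n) z)) = z" for n z
    using r[of n] by (simp add: c_def com_smul[OF central_com[OF quad_central]])
  have c_bij: "bij (c n)" for n
  proof -
    obtain z where "quad (a n) (b n) z \<noteq> 0" using quad_nonzero by (auto simp: quad_def)
    then have "c n z \<noteq> 0" using r[of n] by (simp add: c_def)
    then show ?thesis by (rule com_cases[OF central_com[OF c_central]])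
  qed
  have "(\<lambda>n. c n z) \<longlonglongrightarrow> z" for z
  proof -
    have "c n z = smul (1 / r n) (T (T z)) + smul (- 2 * (a n / r n)) (T z) + z" for n
      using r[of n] by (simp add: c_def quad_def scale_right_distrib scale_right_diff_distrib flip: r_def)
    moreover have "(\<lambda>n. smul (1 / r n) (T (T z)) + smul (- 2 * (a n / r n)) (T z) + z)
        \<longlonglongrightarrow> smul 0 (T (T z)) + smul (- 2 * 0) (T z) + z"
      by (intro tendsto_add tendsto_smul tendsto_mult tendsto_const r0 a0)
    ultimately show ?thesis by simp
  qed
  then have "(\<lambda>n. inv (c n) y) \<longlonglongrightarrow> y"
    by (rule inverse_tendsto_id[OF c_central c_bij])
  moreover have "inv (c n) y = smul (r n) (quad_inv (a n) (b n) y)" for n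
    by (rule inv_f_eq[OF bij_is_inj[OF c_bij] inv_c])
  ultimately have lim: "(\<lambda>n. smul (r n) (quad_inv (a n) (b n) y)) \<longlonglongrightarrow> y" by simp
  have "(\<lambda>n. smul (1 / r n) (T (smul (r n) (quad_inv (a n) (b n) y)))
      - smul (a n / r n) (smul (r n) (quad_inv (a n) (b n) y))) \<longlonglongrightarrow> smul 0 (T y) - smul 0 y"
    by (intro tendsto_diff tendsto_smul r0 a0 T_tendsto lim)
  then show ?thesis using r by (simp add: T_smul)
qed

section \<open>The complexification and its resolvent identities\<close>

definition cscale :: "complex \<Rightarrow> 'a \<times> 'a \<Rightarrow> 'a \<times> 'a" where
  "cscale l p = (smul (Re l) (fst p) - smul (Im l) (snd p), smul (Re l) (snd p) + smul (Im l) (fst p))"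

text \<open>With a pair \<open>(y, z)\<close> read as \<open>y + i z\<close>, this is the inverse of
  \<open>T - l\<close>, written as \<open>T - cnj l\<close> times the inverse of the real quadratic;
  \<open>D\<close> is the real part of that operator and \<open>Im l\<close> times \<open>V\<close>
  its imaginary part.\<close>

definition resolvent :: "complex \<Rightarrow> 'a \<times> 'a \<Rightarrow> 'a \<times> 'a" where
  "resolvent l p =
    (let V = quad_inv (Re l) (Im l); D = (\<lambda>y. T (V y) - smul (Re l) (V y))
     in (D (fst p) - smul (Im l) (V (snd p)), D (snd p) + smul (Im l) (V (fst p))))"

definition shifted :: "complex \<Rightarrow> 'a \<times> 'a \<Rightarrow> 'a \<times> 'a" where
  "shifted l p = (T (fst p), T (snd p)) - cscale l p"

lemmas scale_distribs = scale_right_distrib scale_left_distrib scale_right_diff_distrib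
  scale_left_diff_distrib

lemma scale_double: "smul (c * 2) y = smul c y + smul c y"
  by (simp flip: scale_left_distrib)

interpretation cscale: vector_space cscale
  by unfold_locales (auto simp: cscale_def scale_distribs algebra_simps)

lemma resolvent_shifted: "resolvent l (shifted l p) = p"
proof -
  have "resolvent l (shifted l p) =
    (quad (Re l) (Im l) (quad_inv (Re l) (Im l) (fst p)), quad (Re l) (Im l) (quad_inv (Re l) (Im l) (snd p)))"
    unfolding resolvent_def shifted_def cscale_def quad_def
    by (simp add: Let_def quad_inv_T quad_inv_add quad_inv_diff quad_inv_smul T_add T_diff T_smul
        power2_eq_square scale_double scale_distribs algebra_simps)
  then show ?thesis by simp
qed

lemma shifted_resolvent: "shifted l (resolvent l p) = p"
proof -
  have "shifted l (resolvent l p) =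
    (quad (Re l) (Im l) (quad_inv (Re l) (Im l) (fst p)), quad (Re l) (Im l) (quad_inv (Re l) (Im l) (snd p)))"
    unfolding resolvent_def shifted_def cscale_def quad_def
    by (simp add: Let_def T_add T_diff T_smul
        power2_eq_square scale_double scale_distribs algebra_simps)
  then show ?thesis by simp
qed

lemma resolvent_add: "resolvent l (p + q) = resolvent l p + resolvent l q"
  by (simp add: resolvent_def Let_def quad_inv_add T_add scale_distribs algebra_simps)

lemma resolvent_cscale: "resolvent l (cscale c p) = cscale c (resolvent l p)"
  by (simp add: resolvent_def cscale_def Let_def quad_inv_add quad_inv_diff quad_inv_smul
      T_add T_diff T_smul scale_distribs algebra_simps)

text \<open>The resolvent identity, obtained by applying the resolvent at \<open>l + h\<close> to
  \<open>p\<close>, decomposed by means of \<open>T - (l + h)\<close> acting on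
  \<open>resolvent l p\<close>.\<close>

lemma resolvent_step: "resolvent (l + h) p = resolvent l p + cscale h (resolvent (l + h) (resolvent l p))"
proof -
  have "shifted (l + h) (resolvent l p) = p - cscale h (resolvent l p)"
    using shifted_resolvent[of l p] by (simp add: shifted_def cscale.scale_left_distrib algebra_simps)
  then have "p = shifted (l + h) (resolvent l p) + cscale h (resolvent l p)" by simp
  then have "resolvent (l + h) p =
      resolvent (l + h) (shifted (l + h) (resolvent l p) + cscale h (resolvent l p))"
    by (rule arg_cong)
  then show ?thesis by (simp only: resolvent_add resolvent_shifted resolvent_cscale)
qed

text \<open>Three uses of the resolvent identity give a second-order Taylor formula with an exact
  cubic remainder; no derivative or integral is required.\<close>

lemma resolvent_expansion:
  fixes l h p
  defines "p1 \<equiv> resolvent l p" and "p2 \<equiv> resolvent l (resolvent l p)"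
    and "p3 \<equiv> resolvent l (resolvent l (resolvent l p))"
  shows "resolvent (l + h) p =
    p1 + cscale h p2 + cscale (h ^ 2) p3 + cscale (h ^ 3) (resolvent (l + h) p3)"
proof -
  have "resolvent (l + h) p = p1 + cscale h (resolvent (l + h) p1)"
    unfolding p1_def by (rule resolvent_step)
  also have "resolvent (l + h) p1 = p2 + cscale h (resolvent (l + h) p2)"
    unfolding p1_def p2_def by (rule resolvent_step)
  also have "resolvent (l + h) p2 = p3 + cscale h (resolvent (l + h) p3)"
    unfolding p2_def p3_def by (rule resolvent_step)
  finally show ?thesis
    by (simp add: cscale.scale_right_distrib power2_eq_square power3_eq_cube add.assoc)
qed

text \<open>The increments are \<open>t\<close> times the fourth roots of unity, whose sum and sum
  of squares vanish, so the linear and quadratic terms cancel. In the remainder the cubes of the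
  imaginary increments turn \<open>fst\<close> into \<open>snd\<close>.\<close>

lemma resolvent_four_points:
  fixes l p and t :: real
  defines "q \<equiv> resolvent l (resolvent l (resolvent l p))"
  shows "fst (resolvent (l + of_real t) p) + fst (resolvent (l + of_real t * \<i>) p)
      + fst (resolvent (l - of_real t) p) + fst (resolvent (l - of_real t * \<i>) p)
    = smul 4 (fst (resolvent l p)) + smul (t ^ 3) (fst (resolvent (l + of_real t) q)
      + snd (resolvent (l + of_real t * \<i>) q) - fst (resolvent (l - of_real t) q)
      - snd (resolvent (l - of_real t * \<i>) q))"
proof -
  define p1 p2 where "p1 = resolvent l p" and "p2 = resolvent l (resolvent l p)"
  note expand = resolvent_expansion[of l _ p, folded q_def, folded p2_def, folded p1_def]
  have e1: "fst (resolvent (l + of_real t) p) = fst p1 + smul t (fst p2) + smul (t^2) (fst q)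
      + smul (t^3) (fst (resolvent (l + of_real t) q))"
    using expand[of "of_real t"] by (simp add: cscale_def power2_eq_square power3_eq_cube)
  have e2: "fst (resolvent (l + of_real t * \<i>) p) = fst p1 - smul t (snd p2) - smul (t^2) (fst q)
      + smul (t^3) (snd (resolvent (l + of_real t * \<i>) q))"
    using expand[of "of_real t * \<i>"] by (simp add: cscale_def power2_eq_square power3_eq_cube)
  have e3: "fst (resolvent (l - of_real t) p) = fst p1 - smul t (fst p2) + smul (t^2) (fst q)
      - smul (t^3) (fst (resolvent (l - of_real t) q))"
    using expand[of "- of_real t"] by (simp add: cscale_def power2_eq_square power3_eq_cube)
  have e4: "fst (resolvent (l - of_real t * \<i>) p) = fst p1 + smul t (snd p2) - smul (t^2) (fst q)
      - smul (t^3) (snd (resolvent (l - of_real t * \<i>) q))"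
    using expand[of "- of_real t * \<i>"] by (simp add: cscale_def power2_eq_square power3_eq_cube)
  have e5: "smul 4 (fst p1) = fst p1 + fst p1 + fst p1 + fst p1"
    using scale_double[of 2 "fst p1"] scale_double[of 1 "fst p1"] by (simp add: add.assoc)
  show ?thesis
    unfolding p1_def[symmetric] e1 e2 e3 e4 e5 by (simp add: scale_distribs)
qed

section \<open>Continuity of the resolvent and the contradiction at its maximum\<close>

lemma resolvent_tendsto:
  assumes "l \<longlonglongrightarrow> l0"
  shows "(\<lambda>n::nat. fst (resolvent (l n) p)) \<longlonglongrightarrow> fst (resolvent l0 p)"
    and "(\<lambda>n::nat. snd (resolvent (l n) p)) \<longlonglongrightarrow> snd (resolvent l0 p)"
proof -
  note V = quad_inv_tendsto[OF tendsto_Re[OF assms] tendsto_Im[OF assms]]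
  note lims = tendsto_diff tendsto_add tendsto_smul V T_tendsto tendsto_Re[OF assms] tendsto_Im[OF assms]
  show "(\<lambda>n::nat. fst (resolvent (l n) p)) \<longlonglongrightarrow> fst (resolvent l0 p)"
    unfolding resolvent_def Let_def fst_conv by (intro lims)
  show "(\<lambda>n::nat. snd (resolvent (l n) p)) \<longlonglongrightarrow> snd (resolvent l0 p)"
    unfolding resolvent_def Let_def snd_conv by (intro lims)
qed

text \<open>Liouville by the maximum principle: \<open>u\<close> is subharmonic by the four-point formula and tends to \<open>0\<close>
  at infinity, so \<open>u l + e |l|\<^sup>2\<close> would have an interior maximum on a large disc, although its
  four-point averages exceed its values.\<close>
lemma inconsistent: False
proof -
  obtain x where "quad 0 0 x \<noteq> 0"
    using quad_nonzero[of 0 0] by (auto simp: quad_def)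
  then have x: "x \<noteq> 0" by (auto simp: com_0[OF central_com[OF quad_central]])
  define R where "R l = fst (resolvent l (x, 0))" for l
  have R_eq: "R l = T (quad_inv (Re l) (Im l) x) - smul (Re l) (quad_inv (Re l) (Im l) x)" for l
    by (simp add: R_def resolvent_def Let_def com_0[OF central_com[OF quad_inv_central]])
  \<comment> \<open>At \<open>0\<close> the resolvent inverts \<open>T\<close>, so
    \<open>R 0\<close> cannot vanish and a gauge \<open>p\<close> detecting it exists.\<close>
  have "T (R 0) = x"
    using quad_quad_inv[of 0 0 x] by (simp add: R_eq quad_def)
  then have "R 0 \<noteq> 0" using x A_0[OF T_in] by auto
  then obtain p where p: "\<And>y. 0 \<le> p y" "\<And>y z. p (y + z) \<le> p y + p z"
    "\<And>t y. 0 \<le> t \<Longrightarrow> p (smul t y) = t * p y"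
    "\<And>f l. f \<longlonglongrightarrow> l \<Longrightarrow> (\<lambda>n. p (f n)) \<longlonglongrightarrow> p l" "0 < p (R 0)"
    using ex_sublinear by blast
  define u where "u l = p (R l)" for l
  have u0: "u 0 > 0" using p(5) by (simp add: u_def)
  have cont: "continuous_on S (\<lambda>l. p (f l))"
    if "\<And>l l0. l \<longlonglongrightarrow> l0 \<Longrightarrow> (\<lambda>n. f (l n)) \<longlonglongrightarrow> f l0" for f :: "complex \<Rightarrow> 'a" and S
    unfolding continuous_on_sequentially o_def
  proof (intro allI ballI impI)
    fix l :: "nat \<Rightarrow> complex" and l0
    assume "(\<forall>n. l n \<in> S) \<and> l \<longlonglongrightarrow> l0"
    then show "(\<lambda>n. p (f (l n))) \<longlonglongrightarrow> p (f l0)" by (intro p(4) that) simp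
  qed
  have u_cont: "continuous_on S u" for S
    unfolding u_def[abs_def] R_def by (rule cont) (rule resolvent_tendsto)
  obtain \<rho> where \<rho>: "\<rho> > 0" "\<And>l. norm l \<ge> \<rho> \<Longrightarrow> u l < u 0 / 2"
  proof (rule ccontr)
    assume "\<not> thesis"
    then have "\<not> (\<forall>l. norm l \<ge> real (Suc n) \<longrightarrow> u l < u 0 / 2)" for n
      using that[of "real (Suc n)"] by (metis of_nat_0_less_iff zero_less_Suc)
    then have "\<exists>l. norm l \<ge> real (Suc n) \<and> u l \<ge> u 0 / 2" for n
      by (metis not_less)
    then obtain l where l: "\<And>n. norm (l n) \<ge> real (Suc n)" "\<And>n. u (l n) \<ge> u 0 / 2" by metis
    have r: "(Re (l n))\<^sup>2 + (Im (l n))\<^sup>2 = (norm (l n))\<^sup>2" for n by (simp add: cmod_power2)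
    have pos: "norm (l n) > 0" for n by (rule less_le_trans[OF _ l(1)]) simp
    have b1: "1 / norm (l n) \<le> inverse (real (Suc n))" for n
      using l(1)[of n] by (simp add: inverse_eq_divide frac_le)
    have b2: "1 / (norm (l n))\<^sup>2 \<le> 1 / norm (l n)" for n
    proof -
      have "1 \<le> norm (l n)" by (rule order_trans[OF _ l(1)]) simp
      then show ?thesis using self_le_power[of "norm (l n)" 2] by (intro frac_le) auto
    qed
    have b3: "\<bar>Re (l n) / (norm (l n))\<^sup>2\<bar> \<le> 1 / norm (l n)" for n
      using abs_Re_le_cmod[of "l n"] pos[of n] by (simp add: field_simps power2_eq_square)
    have "(\<lambda>n. T (quad_inv (Re (l n)) (Im (l n)) x) - smul (Re (l n)) (quad_inv (Re (l n)) (Im (l n)) x)) \<longlonglongrightarrow> 0"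
    proof (rule quad_inv_at_infinity, unfold r)
      show "0 < (norm (l n))\<^sup>2" for n using pos[of n] by simp
      show "(\<lambda>n. 1 / (norm (l n))\<^sup>2) \<longlonglongrightarrow> 0"
        by (rule Lim_null_comparison[OF _ LIMSEQ_inverse_real_of_nat])
          (use order_trans[OF b2 b1] in simp)
      show "(\<lambda>n. Re (l n) / (norm (l n))\<^sup>2) \<longlonglongrightarrow> 0"
        by (rule Lim_null_comparison[OF _ LIMSEQ_inverse_real_of_nat])
          (use order_trans[OF b3 b1] in simp)
    qed
    then have "(\<lambda>n. u (l n)) \<longlonglongrightarrow> p 0" unfolding u_def R_eq by (rule p(4))
    moreover have "p 0 = 0" using p(3)[of 0 0] by simp
    ultimately have "u 0 / 2 \<le> 0" using l(2) by (intro LIMSEQ_le_const) auto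
    then show False using u0 by simp
  qed
  \<comment> \<open>On the circle of radius \<open>\<rho>\<close> the value of \<open>w\<close> is
    then below \<open>u 0 / 2 + e * \<rho>\<^sup>2\<close>, that is, below \<open>w 0\<close>; so
    the maximum is interior.\<close>
  define e where "e = u 0 / (2 * \<rho>\<^sup>2)"
  have e: "e > 0" "e * \<rho>\<^sup>2 = u 0 / 2" using u0 \<rho>(1) by (auto simp: e_def)
  define w where "w l = u l + e * (norm l)\<^sup>2" for l
  have "continuous_on (cball 0 \<rho>) w"
    unfolding w_def[abs_def] by (intro continuous_intros u_cont)
  then obtain c where c: "norm c \<le> \<rho>" "\<And>l. norm l \<le> \<rho> \<Longrightarrow> w l \<le> w c"
    using continuous_attains_sup[of "cball 0 \<rho>" w] \<rho>(1) by auto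
  have c_lt: "norm c < \<rho>"
  proof (rule ccontr)
    assume "\<not> norm c < \<rho>"
    then have "norm c = \<rho>" using c(1) by simp
    then show False using c(2)[of 0] \<rho>(1) \<rho>(2)[of c] e(2) by (simp add: w_def)
  qed
  define q where "q = resolvent c (resolvent c (resolvent c (x, 0)))"
  \<comment> \<open>All signs are included because \<open>p\<close> need not be even;
    \<open>k\<close> dominates whichever signed component occurs in the cubic remainder.\<close>
  define k where "k l = p (fst (resolvent l q)) + p (snd (resolvent l q))
      + p (- fst (resolvent l q)) + p (- snd (resolvent l q))" for l
  have "continuous_on (cball c 1) k"
    unfolding k_def[abs_def]
    by (intro continuous_on_add cont) (auto intro!: resolvent_tendsto tendsto_minus)
  then obtain l1 where l1: "\<forall>l\<in>cball c 1. k l \<le> k l1"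
    using continuous_attains_sup[of "cball c 1" k] by auto
  define K where "K = max 1 (k l1)"
  have K: "K \<ge> 1" "\<And>l. dist c l \<le> 1 \<Longrightarrow> k l \<le> K"
    using l1 by (auto simp: K_def le_max_iff_disj)
  \<comment> \<open>The three bounds keep the four points in the unit disc about \<open>c\<close>,
    where \<open>K\<close> bounds \<open>k\<close>, keep them in the large disc, where
    \<open>w c\<close> is maximal, and give \<open>K * t < e\<close>.\<close>
  define t where "t = min 1 (min (\<rho> - norm c) (e / (2 * K)))"
  have t: "0 < t" "t \<le> 1" "norm c + t \<le> \<rho>" using c_lt e K(1) by (auto simp: t_def)
  have Kt: "K * t < e"
  proof -
    have "t \<le> e / (2 * K)" by (simp add: t_def)
    then show ?thesis using K(1) e(1) by (simp add: field_simps)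
  qed
  define h where "h = complex_of_real t"
  have h: "norm h = t" "norm (h * \<i>) = t" using t by (simp_all add: h_def norm_mult)
  define S where "S f = f (c + h) + f (c + h * \<i>) + f (c - h) + f (c - h * \<i>)" for f :: "complex \<Rightarrow> real"
  have near: "norm (c + h) \<le> \<rho>" "norm (c + h * \<i>) \<le> \<rho>" "norm (c - h) \<le> \<rho>" "norm (c - h * \<i>) \<le> \<rho>"
    using norm_triangle_ineq[of c h] norm_triangle_ineq[of c "h * \<i>"] norm_triangle_ineq4[of c h]
      norm_triangle_ineq4[of c "h * \<i>"] h t by linarith+
  have "S w \<le> 4 * w c" using near[THEN c(2)] by (simp add: S_def)
  moreover have "S w = S u + e * (4 * (norm c)\<^sup>2 + 4 * t\<^sup>2)"
    unfolding S_def w_def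
    by (simp add: cmod_power2 h_def) (simp add: power2_eq_square algebra_simps)
  moreover have "4 * u c \<le> S u + t ^ 3 * (4 * K)"
  proof -
    let ?r = "\<lambda>l. resolvent l q"
    \<comment> \<open>The four-point formula is solved for the value at the centre, hence the
      reversed signs: subadditivity of \<open>p\<close> then bounds \<open>u c\<close> from
      above.\<close>
    define Y where "Y = (- fst (?r (c + h)) + - snd (?r (c + h * \<i>))) + (fst (?r (c - h)) + snd (?r (c - h * \<i>)))"
    have "smul 4 (R c) = (R (c + h) + R (c + h * \<i>)) + (R (c - h) + R (c - h * \<i>)) + smul (t ^ 3) Y"
      using resolvent_four_points[of c t "(x, 0)"]
      by (simp add: R_def Y_def q_def h_def scale_distribs algebra_simps)
    then have "4 * u c = p ((R (c + h) + R (c + h * \<i>)) + (R (c - h) + R (c - h * \<i>)) + smul (t ^ 3) Y)"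
      using p(3)[of 4 "R c"] by (simp add: u_def)
    also have "\<dots> \<le> S u + t ^ 3 * p Y"
      unfolding S_def u_def using p(3)[of "t ^ 3" Y] t(1)
      by (smt (verit) p(2) zero_le_power)
    also have "p Y \<le> k (c + h) + k (c + h * \<i>) + k (c - h) + k (c - h * \<i>)"
      unfolding Y_def k_def by (smt (verit) p(1,2))
    also have "\<dots> \<le> 4 * K"
    proof -
      have "k (c + h) \<le> K" "k (c + h * \<i>) \<le> K" "k (c - h) \<le> K" "k (c - h * \<i>) \<le> K"
        using h t(2) by (auto intro!: K(2) simp: dist_norm)
      then show ?thesis by simp
    qed
    finally show ?thesis using t(1) by (simp add: mult_left_mono)
  qed
  \<comment> \<open>The quadratic gain from the term \<open>e * (norm l)\<^sup>2\<close> is set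
    against the cubic remainder.\<close>
  ultimately have "e * t\<^sup>2 \<le> (K * t) * t\<^sup>2"
    by (simp add: w_def algebra_simps power2_eq_square power3_eq_cube)
  then have "e \<le> K * t" using t(1) by simp
  then show False using Kt by simp
qed

end

section \<open>Hyperinvariant manifolds\<close>

lemma (in irreducible_ops) quadratic:
  "\<exists>a b. \<forall>y. T (T y) + smul (- 2 * a) (T y) + smul (a\<^sup>2 + b\<^sup>2) y = 0"
proof (rule ccontr)
  assume "\<not> ?thesis"
  then have "nonquadratic_ops smul A T" by unfold_locales blast
  then show False by (rule nonquadratic_ops.inconsistent)
qed

lemma frechet_space_of_real:
  fixes scale :: "complex \<Rightarrow> 'a::topological_ab_group_add \<Rightarrow> 'a"
  assumes "frechet_space scale"
  shows "real_frechet_space (\<lambda>r::real. scale (of_real r))"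
proof -
  interpret frechet_space scale by fact
  have "continuous_on UNIV (\<lambda>x::real \<times> 'a. (\<lambda>(c, y). scale c y) (of_real (fst x), snd x))"
    by (rule continuous_on_compose2[OF continuous_scale]) (auto intro!: continuous_intros)
  moreover have "\<exists>V. open V \<and> 0 \<in> V \<and> V \<subseteq> U \<and> convex_wrt (\<lambda>r::real. scale (of_real r)) V"
    if U: "open U" "0 \<in> U" for U
    using locally_convex[OF U] by (simp add: convex_wrt_def)
  ultimately show ?thesis
    using complete_invariant_metric
    by unfold_locales (auto simp: scale_right_distrib scale_left_distrib case_prod_beta)
qed

text \<open>For \<open>A\<close> the continuous commutant of \<open>T\<close>, the absence of a
  nontrivial hyperinvariant manifold is exactly irreducibility; the quadratic relation it forces is
  a vanishing polynomial of degree two.\<close>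

lemma hyperinvariant_real:
  fixes scale :: "real \<Rightarrow> 'a::topological_ab_group_add \<Rightarrow> 'a"
  assumes "frechet_space scale" "T \<in> continuous_linear_ops scale" "nonquadratic scale T"
  shows "\<exists>M. nontrivial_manifold scale M \<and> hyperinvariant scale T M"
proof (rule ccontr)
  assume no: "\<not> ?thesis"
  interpret frechet_space scale by fact
  define A where "A = {S \<in> continuous_linear_ops scale. S \<circ> T = T \<circ> S}"
  interpret irreducible_ops scale A T
  proof
    show "M = {0} \<or> M = UNIV" if "subspace M" "\<And>S. S \<in> A \<Longrightarrow> S ` M \<subseteq> M" for M
      using no that by (auto simp: nontrivial_manifold_def hyperinvariant_def A_def)
  qed (use assms(2) in \<open>auto simp: A_def\<close>)
  obtain a b where ab: "\<And>y. T (T y) + scale (- 2 * a) (T y) + scale (a\<^sup>2 + b\<^sup>2) y = 0"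
    using quadratic by blast
  have "poly_operator scale [:a\<^sup>2 + b\<^sup>2, - 2 * a, 1:] T y = 0" for y
    using ab[of y] by (simp add: poly_operator_def numeral_2_eq_2 algebra_simps)
  then have "vanishing_polynomial scale T [:a\<^sup>2 + b\<^sup>2, - 2 * a, 1:]"
    by (simp add: vanishing_polynomial_def)
  moreover have "degree [:a\<^sup>2 + b\<^sup>2, - 2 * a, 1:] \<le> 2" by simp
  ultimately show False using assms(3) unfolding nonquadratic_def by blast
qed

text \<open>Irreducibility yields a real quadratic relation, which factors as \<open>T - c\<close>
  times \<open>T - cnj c\<close>. The eigenspace of \<open>c\<close> is hyperinvariant, so it is
  zero or everything, and either case makes \<open>T\<close> scalar.\<close>

lemma hyperinvariant_complex:
  fixes scale :: "complex \<Rightarrow> 'a::topological_ab_group_add \<Rightarrow> 'a"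
  assumes "frechet_space scale" "T \<in> continuous_linear_ops scale" "\<not> scalar_operator scale T"
  shows "\<exists>M. nontrivial_manifold scale M \<and> hyperinvariant scale T M"
proof (rule ccontr)
  assume no: "\<not> ?thesis"
  interpret X: frechet_space scale by fact
  have op_iff: "S \<in> continuous_linear_ops scale \<longleftrightarrow> (\<forall>y z. S (y + z) = S y + S z) \<and>
      (\<forall>c y. S (scale c y) = scale c (S y)) \<and> continuous_on UNIV S" for S
    by (auto simp: continuous_linear_ops_def Vector_Spaces.linear_iff X.vector_space_axioms)
  have T_add: "T (y + z) = T y + T z" and T_scale: "T (scale c y) = scale c (T y)" for y z c
    using assms(2) by (simp_all add: op_iff)
  define A where "A = {S \<in> continuous_linear_ops scale. S \<circ> T = T \<circ> S}"
  have trivial: "M = {0} \<or> M = UNIV" if "X.subspace M" "\<And>S. S \<in> A \<Longrightarrow> S ` M \<subseteq> M" for M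
    using no that by (auto simp: nontrivial_manifold_def hyperinvariant_def A_def)
  have scale_A: "scale c \<in> A" for c
  proof -
    have "continuous_on UNIV (\<lambda>y. (\<lambda>(c, y). scale c y) (c, y))"
      by (rule continuous_on_compose2[OF X.continuous_scale]) (auto intro!: continuous_intros)
    then show ?thesis
      by (auto simp: A_def op_iff T_scale X.scale_right_distrib mult.commute fun_eq_iff)
  qed
  interpret real_frechet_space "\<lambda>r::real. scale (of_real r)"
    by (rule frechet_space_of_real) fact
  interpret irreducible_ops "\<lambda>r::real. scale (of_real r)" A T
  proof
    have "continuous_linear_ops scale \<subseteq> continuous_linear_ops (\<lambda>r::real. scale (of_real r))"
      by (auto simp: op_iff continuous_linear_ops_def Vector_Spaces.linear_iff vector_space_axioms)
    then show "A \<subseteq> continuous_linear_ops (\<lambda>r::real. scale (of_real r))"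
      by (auto simp: A_def)
    \<comment> \<open>A real subspace invariant under \<open>A\<close> is a complex one, since
      \<open>A\<close> contains all complex scalar multiplications.\<close>
    show "M = {0} \<or> M = UNIV" if M: "subspace M" "\<And>S. S \<in> A \<Longrightarrow> S ` M \<subseteq> M" for M
    proof (rule trivial[OF _ M(2)])
      show "X.subspace M"
        using M(1) M(2)[OF scale_A] by (auto simp: subspace_def X.subspace_def)
    qed
  qed (use assms(2) in \<open>auto simp: A_def\<close>)
  obtain a b where ab: "\<And>y. T (T y) + scale (of_real (- 2 * a)) (T y) + scale (of_real (a\<^sup>2 + b\<^sup>2)) y = 0"
    using quadratic by blast
  define c where "c = Complex a b"
  have sum: "of_real (- 2 * a) = - c - cnj c" and prod: "of_real (a\<^sup>2 + b\<^sup>2) = c * cnj c"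
    by (simp_all add: c_def complex_eq_iff power2_eq_square)
  have factored: "T (T y - scale (cnj c) y) = scale c (T y - scale (cnj c) y)" for y
  proof -
    have "T (T y - scale (cnj c) y) - scale c (T y - scale (cnj c) y) = 0"
      using ab[of y] T_add[of "T y - scale (cnj c) y" "scale (cnj c) y"] unfolding sum prod
      by (simp add: T_scale X.scale_left_diff_distrib X.scale_right_diff_distrib algebra_simps)
    then show ?thesis by simp
  qed
  define M where "M = {y. T y = scale c y}"
  have "M = {0} \<or> M = UNIV"
  proof (rule trivial)
    show "X.subspace M"
      using T_scale[of 0 0]
      by (auto simp: X.subspace_def M_def T_add T_scale X.scale_right_distrib mult.commute)
    show "S ` M \<subseteq> M" if "S \<in> A" for S
      using that by (auto simp: A_def M_def op_iff fun_eq_iff) metis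
  qed
  then show False
  proof
    assume "M = {0}"
    have "T y = scale (cnj c) y" for y
    proof -
      \<comment> \<open>By the factorization the range of \<open>T - cnj c\<close> lies in the
        eigenspace of \<open>c\<close>, which is zero here.\<close>
      have "T y - scale (cnj c) y \<in> M" unfolding M_def by (rule CollectI) (rule factored)
      then show ?thesis unfolding \<open>M = {0}\<close> by simp
    qed
    then show False using assms(3) unfolding scalar_operator_def by blast
  next
    assume "M = UNIV"
    then have "T y = scale c y" for y unfolding M_def by blast
    then show False using assms(3) unfolding scalar_operator_def by blast
  qed
qed

theorem corollary3p2:
  fixes scaleC :: "complex \<Rightarrow> 'a::topological_ab_group_add \<Rightarrow> 'a"
    and scaleR :: "real \<Rightarrow> 'b::topological_ab_group_add \<Rightarrow> 'b"
  shows "(frechet_space scaleC \<longrightarrow>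
            (\<forall>T\<in>continuous_linear_ops scaleC. \<not> scalar_operator scaleC T \<longrightarrow>
              (\<exists>M. nontrivial_manifold scaleC M \<and> hyperinvariant scaleC T M))) \<and>
         (frechet_space scaleR \<longrightarrow>
            (\<forall>T\<in>continuous_linear_ops scaleR. nonquadratic scaleR T \<longrightarrow>
              (\<exists>M. nontrivial_manifold scaleR M \<and> hyperinvariant scaleR T M)))"
  by (intro conjI impI ballI hyperinvariant_complex hyperinvariant_real)

end
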